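(* Let $N=3$, $p>5$, $\lambda>0$ and $0<a<b<\infty$, and set \[ r_0=\sqrt{\frac{2(p-5)}{\lambda(p+3)^2}} \] (this is $r_0=\sqrt{\frac{2((N-2)p+N-4)((N-2)p-(N+2))}{\lambda(p-1)(p+3)^2}}$ with $N=3$). Assume one of the following: (i) ($r_0\le a$ or $b\le r_0$) and $b<a+\pi/\sqrt{\lambda}$; (ii) $a<r_0<b$ and \[ a+\frac{\pi}{\sqrt{\lambda}}-\frac{1}{\sqrt{\lambda}}\arctan\left(\frac{2(p+3)\sqrt{\lambda}}{p-5}a\right)\le b<a+\frac{\pi}{\sqrt{\lambda}}; \] (iii) $a<r_0<b$ and \[ b\le -a+\frac{1}{\sqrt{\lambda}}\left(\frac{2\sqrt{2(p-5)}}{p+3}+\arccos\left(-\sqrt{\frac{p-5}{p+3}}\right)\right). \] Then the problem \[ u''+\frac{2}{r}u'+\lambda u+u^p=0,\quad r\in(a,b),\qquad u(a)=u(b)=0, \] has a unique positive solution (i.e. exactly one solution with $u(r)>0$ for $r\in(a,b)$).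
   Context: For $N=3$, the first Dirichlet eigenvalue of the Laplacian on the annulus $\{x\in\mathbb{R}^3: a<|x|<b\}$ is $\pi^2/(b-a)^2$, so $b<a+\pi/\sqrt{\lambda}$ is equivalent to $\lambda$ being less than this first eigenvalue. A positive solution means a $C^2$ solution on $[a,b]$ that is positive on $(a,b)$. *)

theory Defs
  imports "HOL-Analysis.Analysis"
begin

definition pos_sol :: "real \<Rightarrow> real \<Rightarrow> real \<Rightarrow> real \<Rightarrow> (real \<Rightarrow> real) \<Rightarrow> bool" where
  "pos_sol lam p a b u \<longleftrightarrow>
     (\<exists>u' u''.
        (\<forall>x\<in>{a..b}. (u has_real_derivative u' x) (at x within {a..b}) \<and>
                     (u' has_real_derivative u'' x) (at x within {a..b})) \<and>
        continuous_on {a..b} u'' \<and>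
        (\<forall>r\<in>{a<..<b}. u'' r + 2 / r * u' r + lam * u r + u r powr p = 0)) \<and>
     u a = 0 \<and> u b = 0 \<and> (\<forall>r\<in>{a<..<b}. u r > 0)"

end

theory Submission
  imports Defs
begin

text \<open>
  With \<open>v r = r u r\<close> the equation becomes \<open>v'' + lam v + r\<^sup>1\<^sup>-\<^sup>p v\<^sup>p = 0\<close>. Existence is by shooting from
  \<open>a\<close>: a solution with small slope at \<open>a\<close> stays positive up to \<open>b\<close>, one with large slope does not.

  For uniqueness, deform the slope from \<open>0\<close> up to the smallest admissible one to see that any
  other solution \<open>v\<^sub>2\<close> crosses the solution \<open>v\<^sub>1\<close> of smallest slope only once, so that \<open>v\<^sub>2 / v\<^sub>1\<close> is
  nonincreasing. The Pohozaev identity with the multiplier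
  \<open>T r = sin (w (r - a)) sin (w (b - r))\<close>, \<open>w = sqrt lam\<close>, has no boundary terms and no quadratic
  terms; it says that \<open>(r T' - k T) r\<^sup>-\<^sup>p v\<^sup>p\<^sup>+\<^sup>1\<close> has integral \<open>0\<close> over \<open>(a, b)\<close>, where
  \<open>k = 2 (p - 1) / (p + 3)\<close>. Each of the three hypotheses makes \<open>r T' - k T\<close> change sign exactly
  once. As \<open>v\<^sub>2 / v\<^sub>1\<close> is monotone, the identity cannot hold for both \<open>v\<^sub>1\<close> and \<open>v\<^sub>2\<close> unless they are
  proportional, hence equal.
\<close>

section \<open>Second-order initial value problems\<close>

text \<open>The substitution removes the first-order term, and for N = 3 the remaining linear part
  has constant coefficients; hence the explicit sines. \<open>T\<close> is a product of two
  solutions of \<open>z'' + w^2 z = 0\<close>, so \<open>T''' = - 4 w^2 T'\<close>, which is exactly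
  the relation that cancels the terms in \<open>v^2\<close>. The power terms then leave
  \<open>T'\<close> with weight \<open>2 (p + 3) / (p + 1)\<close> and \<open>T / r\<close> with
  weight \<open>- 4 (p - 1) / (p + 1)\<close>; their quotient gives \<open>k\<close>, and
  \<open>p > 5\<close> means \<open>1 < k < 2\<close>. The defect \<open>r T' - k T\<close> is
  positive at \<open>a\<close> and negative from the midpoint on, so the danger is an extra
  oscillation on the left half. The phase of its derivative rises up to \<open>r0\<close> and falls
  afterwards. The hypotheses say that the phase is monotone on the interval, or starts high enough,
  or has a peak that is low enough. Two positive solutions might a priori cross often. Stopping the
  deformation at the least admissible slope keeps the value at \<open>b\<close> positive on the way,
  which blocks crossings from entering there.\<close>

lemma mvt_Icc:
  fixes f f' :: "real \<Rightarrow> real"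
  assumes "\<And>t. t \<in> {a..b} \<Longrightarrow> (f has_real_derivative f' t) (at t within {a..b})"
    and "a \<le> x" "x < y" "y \<le> b"
  obtains z where "x < z" "z < y" "f y - f x = (y - x) * f' z"
proof -
  have "continuous_on {a..b} f"
    using assms(1) by (meson DERIV_continuous_on)
  then have "continuous_on {x..y} f"
    using assms by (auto intro: continuous_on_subset)
  moreover have d: "(f has_real_derivative f' t) (at t)" if "x < t" "t < y" for t
    using assms(1)[of t] assms(2-) that by (simp add: at_within_Icc_at)
  ultimately obtain l z where z: "x < z" "z < y" "DERIV f z :> l" "f y - f x = (y - x) * l"
    using MVT[of x y f] assms(3) by (meson real_differentiable_def)
  then have "l = f' z"
    using d DERIV_unique by blast
  then show ?thesis using z that by blast
qed

lemma pos_right_of_zero: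
  fixes f f' :: "real \<Rightarrow> real"
  assumes d: "(f has_real_derivative l) (at a within {a..b})" and "f a = 0" "l > 0"
  obtains e where "e > 0" "\<And>t. a < t \<Longrightarrow> t < a + e \<Longrightarrow> t \<le> b \<Longrightarrow> f t > 0"
proof -
  obtain e where "e > 0" "\<forall>h>0. a + h \<in> {a..b} \<longrightarrow> h < e \<longrightarrow> f a < f (a + h)"
    using has_real_derivative_pos_inc_right[OF d \<open>l > 0\<close>] by blast
  then show ?thesis
    using that[of e] \<open>f a = 0\<close>
    by (metis add_diff_cancel_left' add.commute atLeastAtMost_iff diff_add_cancel
        diff_gt_0_iff_gt less_diff_eq less_eq_real_def)
qed

text \<open>\<open>f a\<close> may be \<open>0\<close>, as it is for every shooting solution.
  Positivity just right of \<open>a\<close> keeps the compact set of nonpositive points away from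
  \<open>a\<close>, so its minimum is a genuine first zero.\<close>

lemma first_zero:
  fixes f :: "real \<Rightarrow> real"
  assumes cont: "continuous_on {a..b} f" and "e > 0"
    and pos: "\<And>t. a < t \<Longrightarrow> t < a + e \<Longrightarrow> t \<le> b \<Longrightarrow> f t > 0"
    and q: "a < q" "q \<le> b" "f q \<le> 0"
  obtains z where "a < z" "z \<le> q" "f z = 0" "\<And>t. a < t \<Longrightarrow> t < z \<Longrightarrow> f t > 0"
proof -
  have aq: "a + e \<le> q"
    using pos[of q] q by force
  have cont': "continuous_on {a + e..q} f"
    using cont q \<open>e > 0\<close> by (auto intro: continuous_on_subset)
  define S where "S = {t \<in> {a + e..q}. f t \<le> 0}"
  have "closed S"
    unfolding S_def by (intro continuous_on_closed_Collect_le cont' continuous_on_const closed_atLeastAtMost)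
  moreover have "bounded S"
    by (rule bounded_subset[of "{a + e..q}"]) (auto simp: S_def)
  ultimately have "compact S"
    by (simp add: compact_eq_bounded_closed)
  moreover have "q \<in> S" using aq q by (simp add: S_def)
  ultimately obtain z where z: "z \<in> S" "\<And>t. t \<in> S \<Longrightarrow> z \<le> t"
    using compact_attains_inf[of S] by blast
  have pos': "f t > 0" if "a < t" "t < z" for t
    using z that pos[of t] q unfolding S_def by (smt (verit) atLeastAtMost_iff mem_Collect_eq)
  have az: "a < z" "z \<le> q" using z \<open>e > 0\<close> by (auto simp: S_def)
  have "f z = 0"
  proof (rule ccontr)
    assume "f z \<noteq> 0"
    then have "f z < 0" using z by (auto simp: S_def)
    define m where "m = (a + z) / 2"
    have m: "a < m" "m < z" using az by (auto simp: m_def)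
    have "continuous_on {m..z} f"
      using cont m az q by (auto intro: continuous_on_subset)
    then obtain x where "m \<le> x" "x \<le> z" "f x = 0"
      using IVT2'[of f z 0 m] \<open>f z < 0\<close> pos'[OF m] m by auto
    then show False using pos'[of x] m \<open>f z < 0\<close> by (cases "x = z") auto
  qed
  then show ?thesis using that az pos' by blast
qed

text \<open>The switch point is the supremum of the positivity set; inserting \<open>a\<close>
  covers the case without positive values. It serves both the multiplier defect and the difference
  of two solutions.\<close>

lemma sign_switch:
  fixes f :: "real \<Rightarrow> real"
  assumes "a \<le> b"
    and nq: "\<And>r r'. a \<le> r \<Longrightarrow> r < r' \<Longrightarrow> r' \<le> b \<Longrightarrow> f r < 0 \<Longrightarrow> 0 < f r' \<Longrightarrow> False"
  obtains c where "c \<in> {a..b}" "\<And>r. a \<le> r \<Longrightarrow> r < c \<Longrightarrow> f r \<ge> 0" "\<And>r. c < r \<Longrightarrow> r \<le> b \<Longrightarrow> f r \<le> 0"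
proof
  define S where "S = insert a {r \<in> {a..b}. f r > 0}"
  have aS: "a \<in> S" and Sb: "\<And>r. r \<in> S \<Longrightarrow> r \<le> b"
    using \<open>a \<le> b\<close> by (auto simp: S_def)
  have bdd: "bdd_above S"
    using Sb by (meson bdd_aboveI)
  have upper: "r \<le> Sup S" if "r \<in> S" for r
    using that bdd by (rule cSup_upper)
  show "Sup S \<in> {a..b}"
    using upper[OF aS] cSup_least[of S b] aS Sb by auto
  show "f r \<ge> 0" if "a \<le> r" "r < Sup S" for r
  proof -
    have "\<exists>r'\<in>S. r < r'"
      using \<open>r < Sup S\<close> aS bdd less_cSup_iff[of S r] by auto
    then obtain r' where r': "r' \<in> S" "r < r'" by blast
    then have "f r' > 0" "r' \<le> b"
      using \<open>a \<le> r\<close> by (auto simp: S_def)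
    then show ?thesis
      using nq[of r r'] \<open>a \<le> r\<close> r' by force
  qed
  show "f r \<le> 0" if "Sup S < r" "r \<le> b" for r
  proof (rule ccontr)
    assume "\<not> f r \<le> 0"
    then have "r \<in> S" using that upper[OF aS] by (simp add: S_def)
    then show False using upper[of r] that by simp
  qed
qed

text \<open>The energy \<open>e = D^2 + D'^2\<close> satisfies \<open>|e'| <= (1 + L) e\<close>,
  because \<open>2 |D D'| <= e\<close> controls both cross terms. The base point \<open>c\<close> is
  arbitrary since uniqueness is also applied backwards from interior contacts.\<close>

lemma second_order_gronwall:
  fixes D D' D'' :: "real \<Rightarrow> real"
  assumes d: "\<And>t. t \<in> {a..b} \<Longrightarrow> (D has_real_derivative D' t) (at t within {a..b})"
    and d': "\<And>t. t \<in> {a..b} \<Longrightarrow> (D' has_real_derivative D'' t) (at t within {a..b})"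
    and L: "\<And>t. t \<in> {a..b} \<Longrightarrow> \<bar>D'' t\<bar> \<le> L * \<bar>D t\<bar>"
    and "L \<ge> 0" and c: "c \<in> {a..b}" and r: "r \<in> {a..b}"
  shows "(D r)\<^sup>2 + (D' r)\<^sup>2 \<le> ((D c)\<^sup>2 + (D' c)\<^sup>2) * exp ((1 + L) * \<bar>r - c\<bar>)"
proof -
  define e where "e t = (D t)\<^sup>2 + (D' t)\<^sup>2" for t
  define e' where "e' t = 2 * D t * D' t + 2 * D' t * D'' t" for t
  have de: "(e has_real_derivative e' t) (at t within {a..b})" if "t \<in> {a..b}" for t
    unfolding e_def e'_def using d[OF that] d'[OF that]
    by (auto intro!: derivative_eq_intros)
  have be: "\<bar>e' t\<bar> \<le> (1 + L) * e t" if "t \<in> {a..b}" for t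
  proof -
    have "0 \<le> (\<bar>D t\<bar> - \<bar>D' t\<bar>)\<^sup>2" by simp
    then have am: "2 * (\<bar>D t\<bar> * \<bar>D' t\<bar>) \<le> e t"
      by (simp add: e_def power2_diff)
    have "\<bar>e' t\<bar> \<le> 2 * (\<bar>D t\<bar> * \<bar>D' t\<bar>) + 2 * (\<bar>D' t\<bar> * \<bar>D'' t\<bar>)"
      unfolding e'_def by (rule order.trans[OF abs_triangle_ineq]) (simp add: abs_mult)
    also have "\<dots> \<le> 2 * (\<bar>D t\<bar> * \<bar>D' t\<bar>) + 2 * (\<bar>D' t\<bar> * (L * \<bar>D t\<bar>))"
      using L[OF that] by (intro add_left_mono mult_left_mono) auto
    also have "\<dots> = (1 + L) * (2 * (\<bar>D t\<bar> * \<bar>D' t\<bar>))" by (simp add: algebra_simps)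
    also have "\<dots> \<le> (1 + L) * e t"
      using am \<open>L \<ge> 0\<close> by (intro mult_left_mono) auto
    finally show ?thesis .
  qed
  have conte: "continuous_on {a..b} e"
    using de by (meson DERIV_continuous_on)
  have de': "(e has_real_derivative e' t) (at t)" if "a < t" "t < b" for t
    using de[of t] that by (simp add: at_within_Icc_at)
  show ?thesis
  proof (cases "c \<le> r")
    case True
    have "e r * exp (- (1 + L) * r) \<le> e c * exp (- (1 + L) * c)"
    proof (rule DERIV_nonpos_imp_decreasing_open[OF True])
      fix t assume t: "c < t" "t < r"
      have "((\<lambda>t. e t * exp (- (1 + L) * t)) has_real_derivative
          (e' t - (1 + L) * e t) * exp (- (1 + L) * t)) (at t)"
        using de'[of t] t c r by (auto intro!: derivative_eq_intros simp: algebra_simps)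
      moreover have "e' t - (1 + L) * e t \<le> 0"
        using be[of t] t c r by auto
      ultimately show "\<exists>y. ((\<lambda>t. e t * exp (- (1 + L) * t)) has_real_derivative y) (at t) \<and> y \<le> 0"
        by (meson exp_ge_zero mult_nonpos_nonneg)
    next
      show "continuous_on {c..r} (\<lambda>t. e t * exp (- (1 + L) * t))"
        by (intro continuous_intros continuous_on_subset[OF conte]) (use c r in auto)
    qed
    then have "e r * exp (- (1 + L) * r) * exp ((1 + L) * r) \<le> e c * exp (- (1 + L) * c) * exp ((1 + L) * r)"
      by (rule mult_right_mono) simp
    then show ?thesis
      using True by (simp add: e_def mult.assoc exp_add[symmetric] algebra_simps)
  next
    case False
    then have rc: "r \<le> c" by simp
    have "e r * exp ((1 + L) * r) \<le> e c * exp ((1 + L) * c)"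
    proof (rule DERIV_nonneg_imp_increasing_open[OF rc])
      fix t assume t: "r < t" "t < c"
      have "((\<lambda>t. e t * exp ((1 + L) * t)) has_real_derivative
          (e' t + (1 + L) * e t) * exp ((1 + L) * t)) (at t)"
        using de'[of t] t c r by (auto intro!: derivative_eq_intros simp: algebra_simps)
      moreover have "e' t + (1 + L) * e t \<ge> 0"
        using be[of t] t c r by auto
      ultimately show "\<exists>y. ((\<lambda>t. e t * exp ((1 + L) * t)) has_real_derivative y) (at t) \<and> y \<ge> 0"
        by (meson exp_ge_zero mult_nonneg_nonneg)
    next
      show "continuous_on {r..c} (\<lambda>t. e t * exp ((1 + L) * t))"
        by (intro continuous_intros continuous_on_subset[OF conte]) (use c r in auto)
    qed
    then have "e r * exp ((1 + L) * r) * exp (- (1 + L) * r) \<le> e c * exp ((1 + L) * c) * exp (- (1 + L) * r)"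
      by (rule mult_right_mono) simp
    then show ?thesis
      using False by (simp add: e_def mult.assoc exp_add[symmetric] algebra_simps)
  qed
qed

text \<open>The equation \<open>v'' + F r v = 0\<close> as a system: \<open>y\<close> carries the
  slope, so that initial slopes and transversality are statements about \<open>y\<close>.
  Derivatives within the closed interval give it a meaning at both end points.\<close>

definition ode_sol ::
  "(real \<Rightarrow> real \<Rightarrow> real) \<Rightarrow> real \<Rightarrow> real \<Rightarrow> (real \<Rightarrow> real) \<Rightarrow> (real \<Rightarrow> real) \<Rightarrow> bool" where
  "ode_sol F a b v y \<longleftrightarrow> (\<forall>r\<in>{a..b}. (v has_real_derivative y r) (at r within {a..b}) \<and>
     (y has_real_derivative - F r (v r)) (at r within {a..b}))"

lemma ode_solD:
  assumes "ode_sol F a b v y" "r \<in> {a..b}"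
  shows "(v has_real_derivative y r) (at r within {a..b})"
    and "(y has_real_derivative - F r (v r)) (at r within {a..b})"
  using assms by (auto simp: ode_sol_def)

lemma ode_sol_interior:
  assumes "ode_sol F a b v y" "a < r" "r < b"
  shows "(v has_real_derivative y r) (at r)" "(y has_real_derivative - F r (v r)) (at r)"
  using ode_solD[OF assms(1), of r] assms(2,3) by (simp_all add: at_within_Icc_at)

lemma ode_sol_continuous:
  assumes "ode_sol F a b v y"
  shows "continuous_on {a..b} v" "continuous_on {a..b} y"
  by (rule DERIV_continuous_on, erule ode_solD[OF assms])+

lemma ode_sol_gronwall:
  assumes "ode_sol F a b v y" "ode_sol F a b v' y'" "L \<ge> 0"
    and L: "\<And>r x x'. r \<in> {a..b} \<Longrightarrow> \<bar>F r x - F r x'\<bar> \<le> L * \<bar>x - x'\<bar>"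
    and "c \<in> {a..b}" "r \<in> {a..b}"
  shows "(v r - v' r)\<^sup>2 + (y r - y' r)\<^sup>2
    \<le> ((v c - v' c)\<^sup>2 + (y c - y' c)\<^sup>2) * exp ((1 + L) * \<bar>r - c\<bar>)"
proof (rule second_order_gronwall[where D'' = "\<lambda>r. - F r (v r) - - F r (v' r)"])
  fix t assume t: "t \<in> {a..b}"
  show "((\<lambda>r. v r - v' r) has_real_derivative y t - y' t) (at t within {a..b})"
    "((\<lambda>r. y r - y' r) has_real_derivative - F t (v t) - - F t (v' t)) (at t within {a..b})"
    by (intro DERIV_diff ode_solD[OF assms(1) t] ode_solD[OF assms(2) t])+
  show "\<bar>- F t (v t) - - F t (v' t)\<bar> \<le> L * \<bar>v t - v' t\<bar>"
    using L[OF t, of "v t" "v' t"] by linarith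
qed (use assms in auto)

lemma ode_sol_unique:
  assumes "ode_sol F a b v y" "ode_sol F a b v' y'" "L \<ge> 0"
    and "\<And>r x x'. r \<in> {a..b} \<Longrightarrow> \<bar>F r x - F r x'\<bar> \<le> L * \<bar>x - x'\<bar>"
    and "c \<in> {a..b}" "v c = v' c" "y c = y' c" "r \<in> {a..b}"
  shows "v r = v' r" "y r = y' r"
  using ode_sol_gronwall[OF assms(1-5,8)] assms(6,7)
  by (simp_all add: sum_power2_le_zero_iff)

text \<open>The weight \<open>exp (m (r - a))\<close> turns the Volterra operator into a contraction
  on the whole interval.\<close>

lemma ode_sol_exists:
  assumes "a < b" "L \<ge> 0"
    and cont: "continuous_on ({a..b} \<times> UNIV) (\<lambda>(r, x). F r x)"
    and L: "\<And>r x x'. r \<in> {a..b} \<Longrightarrow> \<bar>F r x - F r x'\<bar> \<le> L * \<bar>x - x'\<bar>"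
  obtains v y where "ode_sol F a b v y" "v a = 0" "y a = s"
proof -
  \<comment> \<open>Integrating twice against the weight \<open>E\<close> costs
    \<open>1 / m^2\<close>, so this value gives the contraction factor
    \<open>L / (2 L + 1) <= 1 / 2\<close>.\<close>
  define m where "m = sqrt (2 * L + 1)"
  have m: "m > 0" "m\<^sup>2 = 2 * L + 1"
    using \<open>L \<ge> 0\<close> by (auto simp: m_def)
  define E where "E r = exp (m * (r - a))" for r
  have Epos: "E r > 0" for r by (simp add: E_def)
  have contE: "continuous_on S E" for S
    unfolding E_def by (intro continuous_intros)
  define Y where "Y v r = s - integral {a..r} (\<lambda>t. F t (v t))" for v :: "real \<Rightarrow> real" and r
  define V where "V v r = integral {a..r} (Y v)" for v :: "real \<Rightarrow> real" and r
  have contF: "continuous_on {a..b} (\<lambda>t. F t (v t))" if "continuous_on {a..b} v" for v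
  proof -
    have "continuous_on {a..b} (\<lambda>t. (t, v t))"
      using that by (intro continuous_intros)
    from continuous_on_compose2[OF cont this] show ?thesis by auto
  qed
  have dY: "(Y v has_real_derivative - F r (v r)) (at r within {a..b})"
    if "continuous_on {a..b} v" "r \<in> {a..b}" for v r
    unfolding Y_def using integral_has_real_derivative[OF contF[OF that(1)] that(2)]
    by (auto intro!: derivative_eq_intros)
  have contY: "continuous_on {a..b} (Y v)" if "continuous_on {a..b} v" for v
    by (rule DERIV_continuous_on, erule dY[OF that])
  have dV: "(V v has_real_derivative Y v r) (at r within {a..b})"
    if "continuous_on {a..b} v" "r \<in> {a..b}" for v r
    unfolding V_def using integral_has_real_derivative[OF contY[OF that(1)] that(2)] .
  have contV: "continuous_on {a..b} (V v)" if "continuous_on {a..b} v" for v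
    by (rule DERIV_continuous_on, erule dV[OF that])
  have contw: "continuous_on {a..b} (\<lambda>t. E t * apply_bcontfun w t)" for w
    by (intro continuous_intros contE) auto
  have intE: "integral {a..r} E = (E r - 1) / m" if "r \<in> {a..b}" for r
  proof -
    have "(E has_integral (E r / m - E a / m)) {a..r}"
      unfolding E_def using that m
      by (intro fundamental_theorem_of_calculus)
        (auto simp: has_real_derivative_iff_has_vector_derivative[symmetric]
          intro!: derivative_eq_intros)
    then show ?thesis by (simp add: integral_unique E_def diff_divide_distrib)
  qed
  have intcE: "(\<lambda>t. c * E t) integrable_on {x..y}" for c x y
    by (intro integrable_continuous_real continuous_intros contE)
  have estimate: "\<bar>V v r - V v' r\<bar> \<le> L * d / m\<^sup>2 * E r"
    if c: "continuous_on {a..b} v" "continuous_on {a..b} v'" and r: "r \<in> {a..b}"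
      and d: "\<And>t. t \<in> {a..b} \<Longrightarrow> \<bar>v t - v' t\<bar> \<le> d * E t" for v v' r d
  proof -
    have "d \<ge> 0"
      using d[of a] \<open>a < b\<close> by (simp add: E_def)
    have Yd: "\<bar>Y v t - Y v' t\<bar> \<le> L * d / m * E t" if t: "t \<in> {a..b}" for t
    proof -
      have int: "(\<lambda>t. F t (v t)) integrable_on {a..t}" "(\<lambda>t. F t (v' t)) integrable_on {a..t}"
        using contF[OF c(1)] contF[OF c(2)] t
        by (auto intro!: integrable_continuous_real intro: continuous_on_subset)
      have "\<bar>Y v t - Y v' t\<bar> = norm (integral {a..t} (\<lambda>t. F t (v t) - F t (v' t)))"
        using int by (simp add: Y_def integral_diff)
      also have "\<dots> \<le> integral {a..t} (\<lambda>t. L * d * E t)"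
      proof (rule integral_norm_bound_integral)
        fix x assume "x \<in> {a..t}"
        then have x: "x \<in> {a..b}" using t by auto
        show "norm (F x (v x) - F x (v' x)) \<le> L * d * E x"
          using L[OF x, of "v x" "v' x"] mult_left_mono[OF d[OF x] \<open>L \<ge> 0\<close>]
          by (simp add: mult.assoc)
      qed (intro integrable_diff int intcE)+
      also have "\<dots> = L * d * ((E t - 1) / m)"
        using intE[OF t] by simp
      also have "\<dots> \<le> L * d / m * E t"
        using \<open>L \<ge> 0\<close> \<open>d \<ge> 0\<close> m by (simp add: field_simps)
      finally show ?thesis .
    qed
    have int: "Y v integrable_on {a..r}" "Y v' integrable_on {a..r}"
      using contY[OF c(1)] contY[OF c(2)] r
      by (auto intro!: integrable_continuous_real intro: continuous_on_subset)
    have "\<bar>V v r - V v' r\<bar> = norm (integral {a..r} (\<lambda>t. Y v t - Y v' t))"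
      using int by (simp add: V_def integral_diff)
    also have "\<dots> \<le> integral {a..r} (\<lambda>t. L * d / m * E t)"
    proof (rule integral_norm_bound_integral)
      show "norm (Y v x - Y v' x) \<le> L * d / m * E x" if "x \<in> {a..r}" for x
        using Yd[of x] r that by simp
    qed (intro integrable_diff int intcE)+
    also have "\<dots> = L * d / m * ((E r - 1) / m)"
      using intE[OF r] by simp
    also have "\<dots> \<le> L * d / m\<^sup>2 * E r"
      using \<open>L \<ge> 0\<close> \<open>d \<ge> 0\<close> m(1) by (simp add: field_simps power2_eq_square)
    finally show ?thesis .
  qed
  \<comment> \<open>The fixed point is sought for the quotient \<open>v / E\<close>. Clamping
    extends a function on \<open>{a..b}\<close> to a bounded continuous one on the whole line, a
    complete type to which Banach's theorem applies.\<close>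
  have "\<exists>g. \<forall>x. apply_bcontfun g x = V (\<lambda>t. E t * apply_bcontfun w t) (clamp a b x) / E (clamp a b x)"
    for w :: "real \<Rightarrow>\<^sub>C real"
  proof -
    have "continuous_on (cbox a b) (\<lambda>r. V (\<lambda>t. E t * apply_bcontfun w t) r / E r)"
      unfolding cbox_interval using Epos
      by (intro continuous_intros contV contw contE) (auto simp: less_imp_neq[symmetric])
    then show ?thesis by (metis continuous_on_cbox_bcontfunE)
  qed
  then obtain T where T: "\<And>w x. apply_bcontfun (T w) x =
      V (\<lambda>t. E t * apply_bcontfun w t) (clamp a b x) / E (clamp a b x)"
    by metis
  have clamp: "clamp a b x \<in> {a..b}" for x
    using clamp_in_interval[of a b x] \<open>a < b\<close> by simp
  have "dist (T w) (T w') \<le> 1 / 2 * dist w w'" for w w'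
  proof (rule dist_bound)
    fix x
    have "\<bar>V (\<lambda>t. E t * apply_bcontfun w t) (clamp a b x) - V (\<lambda>t. E t * apply_bcontfun w' t) (clamp a b x)\<bar>
        \<le> L * dist w w' / m\<^sup>2 * E (clamp a b x)"
    proof (rule estimate[OF contw contw clamp])
      fix t
      have "\<bar>apply_bcontfun w t - apply_bcontfun w' t\<bar> \<le> dist w w'"
        using dist_bounded[of w t w'] by (simp add: dist_real_def)
      then have "E t * \<bar>apply_bcontfun w t - apply_bcontfun w' t\<bar> \<le> E t * dist w w'"
        using Epos[of t] by (intro mult_left_mono) auto
      then show "\<bar>E t * apply_bcontfun w t - E t * apply_bcontfun w' t\<bar> \<le> dist w w' * E t"
        using Epos[of t] by (simp add: abs_mult right_diff_distrib[symmetric] mult.commute)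
    qed
    moreover have "L * dist w w' / m\<^sup>2 \<le> 1 / 2 * dist w w'"
      using \<open>L \<ge> 0\<close> m by (simp add: field_simps)
    ultimately have "\<bar>V (\<lambda>t. E t * apply_bcontfun w t) (clamp a b x) - V (\<lambda>t. E t * apply_bcontfun w' t) (clamp a b x)\<bar>
        \<le> 1 / 2 * dist w w' * E (clamp a b x)"
      using Epos[of "clamp a b x"] mult_right_mono[of "L * dist w w' / m\<^sup>2" "1 / 2 * dist w w'" "E (clamp a b x)"]
      by linarith
    then show "dist (apply_bcontfun (T w) x) (apply_bcontfun (T w') x) \<le> 1 / 2 * dist w w'"
      using Epos[of "clamp a b x"]
      by (simp add: T dist_real_def diff_divide_distrib[symmetric] abs_divide pos_divide_le_eq)
  qed
  then obtain w where w: "T w = w"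
    using banach_fix_type[of "1 / 2" T] by auto
  define v where "v t = E t * apply_bcontfun w t" for t
  have cv: "continuous_on {a..b} v"
    unfolding v_def by (rule contw)
  have vV: "v t = V v t" if "t \<in> {a..b}" for t
  proof -
    have "clamp a b t = t"
      using clamp_cancel_cbox[of t a b] that by simp
    then have "apply_bcontfun w t = V v t / E t"
      using T[of w t] unfolding w v_def by simp
    then show ?thesis using Epos[of t] by (simp add: v_def)
  qed
  show ?thesis
  proof (rule that[of v "Y v"])
    show "ode_sol F a b v (Y v)"
      unfolding ode_sol_def
    proof safe
      fix r assume r: "r \<in> {a..b}"
      show "(v has_real_derivative Y v r) (at r within {a..b})"
        using dV[OF cv r] by (rule has_field_derivative_transform_within[where d = 1]) (use r vV in auto)
      show "(Y v has_real_derivative - F r (v r)) (at r within {a..b})"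
        using dY[OF cv r] .
    qed
    show "v a = 0" using vV[of a] \<open>a < b\<close> by (simp add: V_def)
    show "Y v a = s" by (simp add: Y_def)
  qed
qed

section \<open>The sine multiplier and the Pohozaev identity\<close>

lemma has_real_derivative_sin_product:
  fixes a b w r :: real
  shows "((\<lambda>r. sin (w * (r - a)) * sin (w * (b - r))) has_real_derivative w * sin (w * (a + b - 2 * r))) (at r)"
proof -
  have "w * (a + b - 2 * r) = w * (b - r) - w * (r - a)" by (simp add: algebra_simps)
  then have s: "sin (w * (a + b - 2 * r)) = sin (w * (b - r)) * cos (w * (r - a)) - cos (w * (b - r)) * sin (w * (r - a))"
    by (simp only: sin_diff)
  have "((\<lambda>r. sin (w * (r - a)) * sin (w * (b - r))) has_real_derivative
      cos (w * (r - a)) * w * sin (w * (b - r)) + cos (w * (b - r)) * (- w) * sin (w * (r - a))) (at r)"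
    by (rule DERIV_mult) (auto intro!: derivative_eq_intros)
  moreover have "cos (w * (r - a)) * w * sin (w * (b - r)) + cos (w * (b - r)) * (- w) * sin (w * (r - a))
      = w * sin (w * (a + b - 2 * r))"
    unfolding s by (simp only: right_diff_distrib) simp
  ultimately show ?thesis by (simp only:)
qed

section \<open>Sign changes of the multiplier defect\<close>

definition multiplier_defect :: "real \<Rightarrow> real \<Rightarrow> real \<Rightarrow> real \<Rightarrow> real \<Rightarrow> real" where
  "multiplier_defect w k a b r =
    r * (w * sin (w * (a + b - 2 * r))) - k * (sin (w * (r - a)) * sin (w * (b - r)))"

text \<open>With \<open>T r = sin (w (r - a)) sin (w (b - r))\<close> the defect is \<open>r T' - k T\<close>. Its derivative is
  a negative multiple of \<open>sin (w (a + b - 2 r) + arctan (2 w r / (k - 1)))\<close>, so a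
  second sign change would force \<open>X\<close> to take the signs minus, plus, minus.\<close>

lemma multiplier_sign_aux:
  fixes a b w k r0 :: real
  defines "G \<equiv> multiplier_defect w k a b"
    and "X \<equiv> \<lambda>r. w * (a + b - 2 * r) + arctan (2 * w * r / (k - 1)) - pi"
  assumes w: "w > 0" and k: "1 < k" "k < 2" and a: "0 < a" "a < b" and ab: "w * (b - a) < pi"
    and r0: "r0 \<ge> 0" "4 * (w * r0)\<^sup>2 = (k - 1) * (2 - k)"
    and cases: "r0 \<le> a \<or> b \<le> r0 \<or> X a \<ge> 0 \<or> X r0 \<le> 0"
  shows "G a > 0" "G b < 0"
    and "\<And>r r'. a \<le> r \<Longrightarrow> r < r' \<Longrightarrow> r' \<le> b \<Longrightarrow> G r < 0 \<Longrightarrow> 0 < G r' \<Longrightarrow> False"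
proof -
  define m where "m = (a + b) / 2"
  have m: "a < m" "m < b" "a + b = 2 * m" using a by (auto simp: m_def)
  have s0: "sin (w * (b - a)) > 0"
    using w a ab by (intro sin_gt_zero) auto
  have Ga: "G a = a * w * sin (w * (b - a))"
    by (simp add: G_def multiplier_defect_def algebra_simps)
  have "a + b - 2 * b = - (b - a)" by simp
  then have Gb: "G b = - (b * w * sin (w * (b - a)))"
    by (simp only: G_def multiplier_defect_def mult_minus_right sin_minus) simp
  show "G a > 0" "G b < 0"
    unfolding Ga Gb using a w s0 by auto
  \<comment> \<open>From the midpoint on \<open>T' <= 0 < T\<close>, so \<open>G\<close> can turn
    from negative to positive only left of \<open>m\<close>.\<close>
  have Gright: "G r < 0" if "m \<le> r" "r < b" for r
  proof -
    have "w * (r - a) < w * (b - a)" "w * (b - r) < w * (b - a)" "w * (2 * r - a - b) < w * (b - a)"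
      using that m w by (auto intro!: mult_strict_left_mono)
    moreover have "0 < w * (r - a)" "0 < w * (b - r)" "0 \<le> w * (2 * r - a - b)"
      using that m w by auto
    ultimately have "sin (w * (r - a)) > 0" "sin (w * (b - r)) > 0" "sin (w * (2 * r - a - b)) \<ge> 0"
      using ab by (auto intro!: sin_gt_zero sin_ge_zero)
    moreover have "sin (w * (a + b - 2 * r)) = - sin (w * (2 * r - a - b))"
      by (simp add: sin_minus[symmetric] algebra_simps)
    ultimately have "r * (w * sin (w * (a + b - 2 * r))) \<le> 0"
      "k * (sin (w * (r - a)) * sin (w * (b - r))) > 0"
      using that m w a k by (auto simp: mult_nonneg_nonneg)
    then show ?thesis by (simp add: G_def multiplier_defect_def)
  qed
  define G' where "G' r = - w * ((k - 1) * sin (w * (a + b - 2 * r)) + 2 * w * r * cos (w * (a + b - 2 * r)))" for r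
  have dG: "(G has_real_derivative G' r) (at r)" for r
    unfolding G_def multiplier_defect_def
    by (rule derivative_eq_intros has_real_derivative_sin_product refl)+
      (simp add: G'_def algebra_simps)
  \<comment> \<open>Amplitude-phase form of \<open>G'\<close>: left of \<open>m\<close> the angle
    \<open>w (a + b - 2 r)\<close> lies in \<open>(0, pi)\<close> and the arctangent in
    \<open>(0, pi / 2)\<close>. So \<open>th\<close> stays in \<open>(0, 2 pi)\<close> and
    \<open>G'\<close> has the sign of \<open>X = th - pi\<close>.\<close>
  define th where "th r = w * (a + b - 2 * r) + arctan (2 * w * r / (k - 1))" for r
  have th: "0 < th r \<and> th r < 2 * pi \<and> (\<exists>c>0. G' r = - c * sin (th r))" if "a < r" "r < m" for r
  proof -
    define q where "q = 2 * w * r / (k - 1)"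
    have q: "q > 0" "2 * w * r = (k - 1) * q"
      using w k that a by (auto simp: q_def)
    have "w * (a + b - 2 * r) < w * (b - a)" "0 < w * (a + b - 2 * r)"
      using that m w by (auto intro!: mult_strict_left_mono)
    moreover have "arctan q > 0" "arctan q < pi / 2"
      using q by simp (rule arctan_ubound)
    ultimately have "0 < th r" "th r < 2 * pi"
      unfolding th_def q_def[symmetric] using ab by linarith+
    have alg: "C * (- w * ((k - 1) * S + (k - 1) * q * D)) = - w * (k - 1) * (S * C + D * (q * C))"
      for C S D :: real by (simp add: algebra_simps)
    have "sin (arctan q) = q * cos (arctan q)"
      by (simp add: sin_arctan cos_arctan)
    moreover have "G' r = - w * ((k - 1) * sin (w * (a + b - 2 * r)) + (k - 1) * q * cos (w * (a + b - 2 * r)))"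
      by (simp add: G'_def q(2))
    moreover have "th r = w * (a + b - 2 * r) + arctan q"
      by (simp add: th_def q_def)
    ultimately have "cos (arctan q) * G' r = - w * (k - 1) * sin (th r)"
      by (simp only: sin_add alg)
    then have "G' r = - (w * (k - 1) / cos (arctan q)) * sin (th r)"
      using cos_gt_zero_pi[OF arctan_lbound arctan_ubound, of q] by (simp add: field_simps)
    moreover have "w * (k - 1) / cos (arctan q) > 0"
      using w k cos_gt_zero_pi[OF arctan_lbound arctan_ubound, of q] by simp
    ultimately show ?thesis using \<open>0 < th r\<close> \<open>th r < 2 * pi\<close> by blast
  qed
  have X_th: "X r = th r - pi" for r
    by (simp add: X_def th_def)
  have G'X: "X r < 0" if "G' r < 0" "a < r" "r < m" for r
  proof (rule ccontr)
    assume "\<not> X r < 0"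
    then have "sin (th r) \<le> 0"
      using th[OF that(2,3)] sin_ge_zero[of "th r - pi"] by (auto simp: X_th sin_diff)
    then show False
      using th[OF that(2,3)] that(1) by (auto simp: zero_less_mult_iff)
  qed
  have G'X': "X r > 0" if "G' r > 0" "a < r" "r < m" for r
  proof (rule ccontr)
    assume "\<not> X r > 0"
    then have "sin (th r) \<ge> 0"
      using th[OF that(2,3)] by (intro sin_ge_zero) (auto simp: X_th)
    then show False
      using th[OF that(2,3)] that(1) by (auto simp: mult_less_0_iff)
  qed
  define X' where "X' r = - 2 * w + (2 * w / (k - 1)) / (1 + (2 * w * r / (k - 1))\<^sup>2)" for r
  have dX: "(X has_real_derivative X' r) (at r)" for r
    unfolding X_def X'_def
    by (auto intro!: derivative_eq_intros simp: divide_inverse)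
  \<comment> \<open>On the nonnegative axis the numerator vanishes exactly at \<open>r0\<close>,
    which is the origin of \<open>r0\<close>: \<open>X\<close> rises up to there and falls
    afterwards.\<close>
  have X'_eq: "X' r = 2 * w * ((k - 1) * (2 - k) - 4 * (w * r)\<^sup>2) / ((k - 1)\<^sup>2 + 4 * (w * r)\<^sup>2)" for r
  proof -
    define Q where "Q = (k - 1)\<^sup>2 + 4 * (w * r)\<^sup>2"
    have Q: "Q > 0" unfolding Q_def using k by (simp add: add_pos_nonneg)
    have "1 + (2 * w * r / (k - 1))\<^sup>2 = Q / (k - 1)\<^sup>2"
      using k by (simp add: Q_def power_divide power_mult_distrib field_simps)
    then have "X' r = - 2 * w + 2 * w * (k - 1) / Q"
      using k by (simp add: X'_def power2_eq_square)
    also have "\<dots> = 2 * w * ((k - 1) - Q) / Q"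
      using Q by (simp add: field_simps)
    also have "(k - 1) - Q = (k - 1) * (2 - k) - 4 * (w * r)\<^sup>2"
      by (simp add: Q_def power2_eq_square algebra_simps)
    finally show ?thesis by (simp add: Q_def)
  qed
  have den: "(k - 1)\<^sup>2 + 4 * (w * r)\<^sup>2 > 0" for r
    using k by (simp add: add_pos_nonneg)
  have inc: "X r \<le> X r'" if "0 \<le> r" "r \<le> r'" "r' \<le> r0" for r r'
  proof (rule DERIV_nonneg_imp_nondecreasing[OF \<open>r \<le> r'\<close>])
    fix x assume "r \<le> x" "x \<le> r'"
    then have "(w * x)\<^sup>2 \<le> (w * r0)\<^sup>2"
      using that w by (intro power_mono mult_left_mono) auto
    then have "X' x \<ge> 0"
      unfolding X'_eq using w den[of x] r0 by (intro divide_nonneg_pos mult_nonneg_nonneg) auto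
    then show "\<exists>y. (X has_real_derivative y) (at x) \<and> 0 \<le> y" using dX by blast
  qed
  have dec: "X r' \<le> X r" if "r0 \<le> r" "r \<le> r'" for r r'
  proof (rule DERIV_nonpos_imp_nonincreasing[OF \<open>r \<le> r'\<close>])
    fix x assume "r \<le> x" "x \<le> r'"
    then have "(w * r0)\<^sup>2 \<le> (w * x)\<^sup>2"
      using that w r0 by (intro power_mono mult_left_mono) auto
    then have "X' x \<le> 0"
      unfolding X'_eq using w den[of x] r0 by (intro divide_nonpos_pos mult_nonneg_nonpos) auto
    then show "\<exists>y. (X has_real_derivative y) (at x) \<and> y \<le> 0" using dX by blast
  qed
  show False if r: "a \<le> r" "r < r'" "r' \<le> b" "G r < 0" "0 < G r'" for r r'
  proof -
    have "r \<noteq> a" "r' \<noteq> b" using \<open>G a > 0\<close> \<open>G b < 0\<close> r by auto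
    then have ar: "a < r" "r' < b" using r by auto
    then have r'm: "r' < m" using Gright[of r'] r by force
    \<comment> \<open>\<open>G\<close> falls from \<open>G a > 0\<close>, rises to
      \<open>G r' > 0\<close> and falls again to \<open>G m < 0\<close>; one mean value point for
      each move.\<close>
    obtain x1 where x1: "a < x1" "x1 < r" "G r - G a = (r - a) * G' x1"
      using MVT2[of a r G G'] ar dG by auto
    obtain x2 where x2: "r < x2" "x2 < r'" "G r' - G r = (r' - r) * G' x2"
      using MVT2[of r r' G G'] r dG by auto
    obtain x3 where x3: "r' < x3" "x3 < m" "G m - G r' = (m - r') * G' x3"
      using MVT2[of r' m G G'] r'm dG by auto
    have "(r - a) * G' x1 < 0" using x1(3) \<open>G a > 0\<close> r by linarith
    then have 1: "X x1 < 0"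
      using x1 r r'm ar by (intro G'X) (auto simp: mult_less_0_iff)
    have "(r' - r) * G' x2 > 0" using x2(3) r by linarith
    then have 2: "X x2 > 0"
      using x2 r r'm ar by (intro G'X') (auto simp: zero_less_mult_iff)
    have "(m - r') * G' x3 < 0" using x3(3) r Gright[of m] m by linarith
    then have 3: "X x3 < 0"
      using x3 r r'm ar by (intro G'X) (auto simp: mult_less_0_iff)
    \<comment> \<open>\<open>X\<close> with its peak at \<open>r0\<close> cannot run through minus,
      plus, minus if it is monotone on the interval, if it starts nonnegative (falling below
      \<open>0\<close> is then possible only past the peak), or if the peak is nonpositive.\<close>
    consider "r0 \<le> a" | "b \<le> r0" | "X a \<ge> 0" | "X r0 \<le> 0" using cases by blast
    then show False
    proof cases
      case 1
      then show False using dec[of x1 x2] x1 x2 \<open>X x1 < 0\<close> 2 by auto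
    next
      case 2
      then show False using inc[of x2 x3] x2 x3 m r ar a \<open>X x2 > 0\<close> 3 by auto
    next
      case 3
      show False
      proof (cases "x1 \<le> r0")
        case True
        then show False using inc[of a x1] x1 a 1 3 by auto
      next
        case False
        then show False using dec[of x1 x2] x1 x2 1 2 by auto
      qed
    next
      case 4
      then show False using inc[of x2 r0] dec[of r0 x2] x2 r ar a 2 by (cases "x2 \<le> r0") auto
    qed
  qed
qed

text \<open>\<open>T''' = - 4 w^2 T'\<close> cancels the terms in \<open>v^2\<close>, and those in
  \<open>v y\<close> and \<open>y^2\<close> cancel in pairs, so only terms with \<open>g\<close> and
  \<open>q\<close> survive. Later \<open>h\<close>, \<open>q\<close>, \<open>c\<close> are
  \<open>r powr (1 - p)\<close>, \<open>v r powr (p + 1)\<close> and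
  \<open>4 / (p + 1)\<close>.\<close>

lemma pohozaev_derivative:
  fixes T T1 T2 h v y q :: "real \<Rightarrow> real"
  assumes d: "(T has_real_derivative T1 r) (at r)" "(T1 has_real_derivative T2 r) (at r)"
      "(T2 has_real_derivative - 4 * w\<^sup>2 * T1 r) (at r)"
      "(h has_real_derivative h') (at r)" "(q has_real_derivative q') (at r)"
      "(v has_real_derivative y r) (at r)" "(y has_real_derivative - (w\<^sup>2 * v r + g)) (at r)"
  shows "((\<lambda>r. 2 * (T r * (y r * y r)) - 2 * (T1 r * (v r * y r)) + T2 r * (v r * v r)
      + 2 * w\<^sup>2 * (T r * (v r * v r)) + c * (T r * (h r * q r))) has_real_derivative
      c * (T1 r * (h r * q r) + T r * (h' * q r + h r * q')) + 2 * T1 r * v r * g - 4 * T r * y r * g) (at r)"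
  by (rule derivative_eq_intros d refl)+ (simp add: algebra_simps)

text \<open>If \<open>v1\<close> is scaled to meet \<open>v2\<close> where \<open>G\<close> switches
  sign, monotonicity of \<open>v2 / v1\<close> gives the difference of the two Pohozaev functionals
  a derivative of one sign, although it vanishes at both ends. The equality case makes the solutions
  proportional near \<open>a\<close>, which the nonlinearity permits only if they are equal there,
  against \<open>slope\<close>.\<close>

lemma no_two_solutions_crossing_once:
  fixes a b w p :: real
  defines "k \<equiv> 2 * (p - 1) / (p + 3)"
  defines "G \<equiv> multiplier_defect w k a b"
  assumes "0 < a" "a < b" "p > 1"
    and sol: "ode_sol F a b v1 y1" "ode_sol F a b v2 y2"
    and F1: "\<And>r. a < r \<Longrightarrow> r < b \<Longrightarrow> F r (v1 r) = w\<^sup>2 * v1 r + r powr (1 - p) * v1 r powr p"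
    and F2: "\<And>r. a < r \<Longrightarrow> r < b \<Longrightarrow> F r (v2 r) = w\<^sup>2 * v2 r + r powr (1 - p) * v2 r powr p"
    and pos: "\<And>r. a < r \<Longrightarrow> r < b \<Longrightarrow> v1 r > 0" "\<And>r. a < r \<Longrightarrow> r < b \<Longrightarrow> v2 r > 0"
    and zero: "v1 a = 0" "v1 b = 0" "v2 a = 0" "v2 b = 0"
    and slope: "y1 a < y2 a"
    and once: "\<And>r r'. a \<le> r \<Longrightarrow> r < r' \<Longrightarrow> r' \<le> b \<Longrightarrow> v2 r - v1 r < 0 \<Longrightarrow> 0 < v2 r' - v1 r' \<Longrightarrow> False"
    and G: "G a > 0" "G b < 0"
      "\<And>r r'. a \<le> r \<Longrightarrow> r < r' \<Longrightarrow> r' \<le> b \<Longrightarrow> G r < 0 \<Longrightarrow> 0 < G r' \<Longrightarrow> False"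
  shows False
proof -
  note d1 = ode_sol_interior[OF sol(1)] and d2 = ode_sol_interior[OF sol(2)]
  note c1 = ode_sol_continuous[OF sol(1)] and c2 = ode_sol_continuous[OF sol(2)]
  have contG: "continuous_on S G" for S
    unfolding G_def multiplier_defect_def by (intro continuous_intros)
  obtain c0 where c0: "c0 \<in> {a..b}" "\<And>r. a \<le> r \<Longrightarrow> r < c0 \<Longrightarrow> G r \<ge> 0" "\<And>r. c0 < r \<Longrightarrow> r \<le> b \<Longrightarrow> G r \<le> 0"
    using sign_switch[of a b G] G(3) \<open>a < b\<close> by (metis less_imp_le)
  \<comment> \<open>The strict signs of \<open>G\<close> at the ends put the switch point
    \<open>c0\<close> strictly inside, where \<open>v1 c0 > 0\<close>, and provide a strip next to
    \<open>a\<close> with \<open>G > 0\<close> for the equality case.\<close>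
  obtain e where e: "e > 0" "\<And>r. a \<le> r \<Longrightarrow> r < a + e \<Longrightarrow> G r > 0"
  proof -
    have "isCont G a" using contG[of UNIV] by (simp add: continuous_on_eq_continuous_at)
    then have "eventually (\<lambda>r. G r > 0) (at a)"
      using G(1) unfolding isCont_def by (rule order_tendstoD)
    then obtain d where "d > 0" "\<And>r. r \<noteq> a \<Longrightarrow> dist r a < d \<Longrightarrow> G r > 0"
      unfolding eventually_at by blast
    then show ?thesis
      using that[of d] G(1) by (metis abs_of_nonneg add_diff_cancel_left' add_less_cancel_left diff_add_cancel diff_ge_0_iff_ge dist_real_def add.commute)
  qed
  obtain e' where e': "e' > 0" "\<And>r. r \<le> b \<Longrightarrow> b - e' < r \<Longrightarrow> G r < 0"
  proof -
    have "isCont G b" using contG[of UNIV] by (simp add: continuous_on_eq_continuous_at)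
    then have "eventually (\<lambda>r. G r < 0) (at b)"
      using G(2) unfolding isCont_def by (rule order_tendstoD)
    then obtain d where "d > 0" "\<And>r. r \<noteq> b \<Longrightarrow> dist r b < d \<Longrightarrow> G r < 0"
      unfolding eventually_at by blast
    then show ?thesis
      using that[of d] G(2) by (smt (verit) dist_real_def)
  qed
  have "a < c0"
  proof (rule ccontr)
    define x where "x = a + min e (b - a) / 2"
    have "a < x" "x < a + e" "x \<le> b" using e(1) \<open>a < b\<close> by (auto simp: x_def min_def field_simps)
    moreover assume "\<not> a < c0"
    ultimately show False using c0(1) c0(3)[of x] e(2)[of x] by auto
  qed
  moreover have "c0 < b"
  proof (rule ccontr)
    define x where "x = b - min e' (b - a) / 2"
    have "x < b" "b - e' < x" "a \<le> x" using e'(1) \<open>a < b\<close> by (auto simp: x_def min_def field_simps)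
    moreover assume "\<not> c0 < b"
    ultimately show False using c0(1) c0(2)[of x] e'(2)[of x] by auto
  qed
  ultimately have c0': "a < c0" "c0 < b" .
  obtain e2 where e2: "e2 > 0" "\<And>t. a < t \<Longrightarrow> t < a + e2 \<Longrightarrow> t \<le> b \<Longrightarrow> v2 t - v1 t > 0"
  proof (rule pos_right_of_zero[of "\<lambda>t. v2 t - v1 t" "y2 a - y1 a" a b])
    show "((\<lambda>t. v2 t - v1 t) has_real_derivative y2 a - y1 a) (at a within {a..b})"
      using \<open>a < b\<close> by (intro DERIV_diff ode_solD[OF sol(1)] ode_solD[OF sol(2)]) auto
  qed (use slope zero that in auto)

  \<comment> \<open>The Wronskian is the numerator of \<open>(v2 / v1)'\<close>. Its derivative has
    the sign of \<open>v1 - v2\<close>, so by the single crossing it first decreases from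
    \<open>0\<close> and then increases to \<open>0\<close>.\<close>
  define W where "W r = y2 r * v1 r - v2 r * y1 r" for r
  have dW: "(W has_real_derivative r powr (1 - p) * (v2 r * v1 r powr p - v1 r * v2 r powr p)) (at r)"
    if "a < r" "r < b" for r
    unfolding W_def using d1[OF that] d2[OF that]
    by (auto intro!: derivative_eq_intros simp: F1[OF that] F2[OF that] algebra_simps)
  have contW: "continuous_on {a..b} W"
    unfolding W_def by (intro continuous_intros c1 c2)
  have pw: "v2 r * v1 r powr p - v1 r * v2 r powr p = v1 r * v2 r * (v1 r powr (p - 1) - v2 r powr (p - 1))"
    if "a < r" "r < b" for r
    using pos[OF that] by (simp add: powr_diff algebra_simps)
  obtain c where c: "c \<in> {a..b}" "\<And>r. a \<le> r \<Longrightarrow> r < c \<Longrightarrow> v2 r - v1 r \<ge> 0"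
      "\<And>r. c < r \<Longrightarrow> r \<le> b \<Longrightarrow> v2 r - v1 r \<le> 0"
    using sign_switch[of a b "\<lambda>r. v2 r - v1 r"] once \<open>a < b\<close> by (metis less_imp_le)
  have W_nonpos: "W r \<le> 0" if r: "a \<le> r" "r \<le> b" for r
  proof (cases "r \<le> c")
    case True
    have "W r \<le> W a"
    proof (rule DERIV_nonpos_imp_decreasing_open[OF r(1)])
      fix x assume x: "a < x" "x < r"
      then have "v1 x powr (p - 1) \<le> v2 x powr (p - 1)"
        using c(2)[of x] pos[of x] True r \<open>p > 1\<close> by (intro powr_mono2) auto
      then have "x powr (1 - p) * (v2 x * v1 x powr p - v1 x * v2 x powr p) \<le> 0"
        using pos[of x] x r by (subst pw) (auto intro!: mult_nonneg_nonpos)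
      then show "\<exists>y. (W has_real_derivative y) (at x) \<and> y \<le> 0"
        using dW[of x] x r by auto
    qed (rule continuous_on_subset[OF contW], use r in auto)
    then show ?thesis by (simp add: W_def zero)
  next
    case False
    have "W r \<le> W b"
    proof (rule DERIV_nonneg_imp_increasing_open[OF r(2)])
      fix x assume x: "r < x" "x < b"
      then have "v2 x powr (p - 1) \<le> v1 x powr (p - 1)"
        using c(3)[of x] pos[of x] False r \<open>p > 1\<close> by (intro powr_mono2) auto
      then have "x powr (1 - p) * (v2 x * v1 x powr p - v1 x * v2 x powr p) \<ge> 0"
        using pos[of x] x r by (subst pw) (auto intro!: mult_nonneg_nonneg)
      then show "\<exists>y. (W has_real_derivative y) (at x) \<and> y \<ge> 0"
        using dW[of x] x r by auto
    qed (rule continuous_on_subset[OF contW], use r in auto)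
    then show ?thesis by (simp add: W_def zero)
  qed
  have ratio: "v2 r' / v1 r' \<le> v2 r / v1 r" if "a < r" "r \<le> r'" "r' < b" for r r'
  proof (rule DERIV_nonpos_imp_nonincreasing[OF that(2)])
    fix x assume x: "r \<le> x" "x \<le> r'"
    then have x': "a < x" "x < b" using that by auto
    have "((\<lambda>r. v2 r / v1 r) has_real_derivative W x / (v1 x * v1 x)) (at x)"
      using DERIV_divide[OF d2(1)[OF x'] d1(1)[OF x']] pos(1)[OF x'] by (simp add: W_def)
    moreover have "W x / (v1 x * v1 x) \<le> 0"
      using W_nonpos[of x] x' pos(1)[OF x'] by (intro divide_nonpos_pos) auto
    ultimately show "\<exists>y. ((\<lambda>r. v2 r / v1 r) has_real_derivative y) (at x) \<and> y \<le> 0" by blast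
  qed

  define T where "T r = sin (w * (r - a)) * sin (w * (b - r))" for r
  define T1 where "T1 r = w * sin (w * (a + b - 2 * r))" for r
  define T2 where "T2 r = - 2 * w\<^sup>2 * cos (w * (a + b - 2 * r))" for r
  have dT: "(T has_real_derivative T1 r) (at r)" for r
    unfolding T_def T1_def by (rule has_real_derivative_sin_product)
  have dT1: "(T1 has_real_derivative T2 r) (at r)" for r
    unfolding T1_def T2_def by (auto intro!: derivative_eq_intros simp: power2_eq_square)
  have dT2: "(T2 has_real_derivative - 4 * w\<^sup>2 * T1 r) (at r)" for r
    unfolding T1_def T2_def by (auto intro!: derivative_eq_intros)
  have contT: "continuous_on S T" "continuous_on S T1" "continuous_on S T2" for S
    unfolding T_def T1_def T2_def by (intro continuous_intros)+
  \<comment> \<open>The factor \<open>4 / (p + 1)\<close> makes the derivative of the power cancel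
    the term \<open>- 4 T y g\<close>. Every summand contains \<open>T\<close> or \<open>v\<close>,
    so \<open>J\<close> vanishes at both ends.\<close>
  define J where "J v y r = 2 * (T r * (y r * y r)) - 2 * (T1 r * (v r * y r)) + T2 r * (v r * v r)
      + 2 * w\<^sup>2 * (T r * (v r * v r)) + 4 / (p + 1) * (T r * (r powr (1 - p) * v r powr (p + 1)))"
    for v y :: "real \<Rightarrow> real" and r
  \<comment> \<open>A positive multiple of \<open>G\<close> for \<open>r > 0\<close>:
    \<open>2 (p + 3) / (p + 1) = 4 / (p + 1) + 2\<close> collects the two \<open>T1\<close> terms,
    and dividing the coefficient of \<open>T\<close> by it produces \<open>k\<close>.\<close>
  define H where "H r = r powr (1 - p) / r * (2 * (p + 3) / (p + 1)) * G r" for r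
  have dJ: "(J v y has_real_derivative H r * v r powr (p + 1)) (at r)"
    if r: "a < r" and v: "v r > 0" and d: "(v has_real_derivative y r) (at r)"
      "(y has_real_derivative - (w\<^sup>2 * v r + r powr (1 - p) * v r powr p)) (at r)" for v y r
  proof -
    have "r > 0" using r \<open>0 < a\<close> by simp
    have h: "((\<lambda>r. r powr (1 - p)) has_real_derivative (1 - p) / r * r powr (1 - p)) (at r)"
    proof (rule DERIV_cong[OF has_real_derivative_powr[OF \<open>r > 0\<close>]])
      have "r powr (1 - p - 1) = r powr (1 - p) / r"
        using \<open>r > 0\<close> by (subst powr_diff) auto
      then show "(1 - p) * r powr (1 - p - 1) = (1 - p) / r * r powr (1 - p)" by simp
    qed
    have vp: "((\<lambda>r. v r powr (p + 1)) has_real_derivative (p + 1) * v r powr p * y r) (at r)"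
      using DERIV_chain2[OF has_real_derivative_powr[OF v, of "p + 1"] d(1)] by simp
    have vv: "v r powr (p + 1) = v r * v r powr p"
      using v by (simp add: powr_add)
    define h0 where "h0 = r powr (1 - p)"
    define V where "V = v r powr p"
    note fold = h0_def[symmetric] V_def[symmetric]
    have "(J v y has_real_derivative
        4 / (p + 1) * (T1 r * (h0 * v r powr (p + 1)) + T r * ((1 - p) / r * h0 * v r powr (p + 1) + h0 * ((p + 1) * V * y r)))
        + 2 * T1 r * v r * (h0 * V) - 4 * T r * y r * (h0 * V)) (at r)"
      using pohozaev_derivative[where T = T and ?T1.0 = T1 and ?T2.0 = T2 and r = r and v = v and y = y
          and w = w and c = "4 / (p + 1)", OF dT dT1 dT2 h vp d]
      unfolding J_def fold .
    moreover have "H r * v r powr (p + 1) = h0 / r * (2 * (p + 3) / (p + 1)) * (r * T1 r - 2 * (p - 1) / (p + 3) * T r) * (v r * V)"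
      by (simp add: H_def G_def multiplier_defect_def T_def T1_def vv k_def fold)
    moreover have "\<dots> = 4 / (p + 1) * (T1 r * (h0 * (v r * V)) + T r * ((1 - p) / r * h0 * (v r * V) + h0 * ((p + 1) * V * y r)))
        + 2 * T1 r * v r * (h0 * V) - 4 * T r * y r * (h0 * V)"
    proof -
      have "p + 3 \<noteq> 0" "p + 1 \<noteq> 0" "r \<noteq> 0" using \<open>p > 1\<close> \<open>r > 0\<close> by auto
      moreover from this have "4 / (p + 1) * (h0 * ((p + 1) * V * y r)) = 4 * h0 * V * y r" by simp
      ultimately show ?thesis
        by (simp add: divide_simps) (simp add: algebra_simps)
    qed
    ultimately show ?thesis by (simp only: vv fold)
  qed
  have contJ: "continuous_on {a..b} (J v y)" if "continuous_on {a..b} v" "continuous_on {a..b} y"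
      "\<And>r. r \<in> {a..b} \<Longrightarrow> v r \<ge> 0" for v y
  proof -
    have "continuous_on {a..b} (\<lambda>r. v r powr (p + 1))"
      using that \<open>p > 1\<close> by (intro continuous_on_powr' continuous_on_const) auto
    moreover have "continuous_on {a..b} (\<lambda>r. r powr (1 - p))"
      using \<open>0 < a\<close> by (intro continuous_on_powr continuous_on_const continuous_on_id) auto
    ultimately show ?thesis
      unfolding J_def
      by (intro continuous_on_add continuous_on_diff continuous_on_mult continuous_on_const contT that)
  qed
  have J0: "J v y r = 0" if "T r = 0" "v r = 0" for v y r
    using that \<open>p > 1\<close> by (simp add: J_def)
  have Tz: "T a = 0" "T b = 0" by (simp_all add: T_def)

  \<comment> \<open>With this factor \<open>w0 v1\<close> lies below \<open>v2\<close> before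
    \<open>c0\<close> and above it afterwards, while \<open>H\<close> passes from plus to minus
    there; hence \<open>Z' <= 0\<close> throughout.\<close>
  define w0 where "w0 = v2 c0 / v1 c0"
  have w0: "w0 > 0" using pos[OF c0'] by (simp add: w0_def)
  define Z where "Z r = w0 powr (p + 1) * J v1 y1 r - J v2 y2 r" for r
  have nonneg: "v1 r \<ge> 0" "v2 r \<ge> 0" if "r \<in> {a..b}" for r
    using that pos[of r] zero by (cases "r = a \<or> r = b"; force)+
  have contZ: "continuous_on {a..b} Z"
    unfolding Z_def by (intro continuous_intros contJ c1 c2 nonneg)
  have dZ: "(Z has_real_derivative H r * ((w0 * v1 r) powr (p + 1) - v2 r powr (p + 1))) (at r)"
    if r: "a < r" "r < b" for r
    unfolding Z_def using d1[OF r] d2[OF r] pos[OF r] w0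
    by (auto intro!: derivative_eq_intros dJ[OF r(1)] simp: F1[OF r] F2[OF r] powr_mult algebra_simps)
  have H_eq_0: "H r = 0 \<longleftrightarrow> G r = 0" if "a < r" for r
    using that \<open>0 < a\<close> \<open>p > 1\<close> by (simp add: H_def)
  have H_nonpos: "H r \<le> 0" if "a < r" "G r \<le> 0" for r
  proof -
    have "r powr (1 - p) / r * (2 * (p + 3) / (p + 1)) \<ge> 0"
      using that \<open>0 < a\<close> \<open>p > 1\<close> by simp
    then show ?thesis unfolding H_def using that(2) by (rule mult_nonneg_nonpos)
  qed
  have dZ_nonpos: "H r * ((w0 * v1 r) powr (p + 1) - v2 r powr (p + 1)) \<le> 0"
    if r: "a < r" "r < b" for r
  proof (cases "r < c0")
    case True
    have "w0 * v1 r \<le> v2 r"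
      using ratio[of r c0] True r c0' pos[OF r] by (simp add: w0_def pos_le_divide_eq)
    then have "(w0 * v1 r) powr (p + 1) \<le> v2 r powr (p + 1)"
      using w0 pos[OF r] \<open>p > 1\<close> by (intro powr_mono2) auto
    moreover have "H r \<ge> 0"
      using c0(2)[of r] True r \<open>0 < a\<close> \<open>p > 1\<close> by (simp add: H_def)
    ultimately show ?thesis by (simp add: mult_nonneg_nonpos)
  next
    case False
    have "v2 r \<le> w0 * v1 r"
      using ratio[of c0 r] False r c0' pos[OF r] by (simp add: w0_def pos_divide_le_eq)
    then have "v2 r powr (p + 1) \<le> (w0 * v1 r) powr (p + 1)"
      using w0 pos[OF r] \<open>p > 1\<close> by (intro powr_mono2) auto
    moreover have "r = c0 \<or> H r \<le> 0"
      using c0(3)[of r] False r H_nonpos[of r] by (cases "r = c0") auto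
    moreover have "w0 * v1 c0 = v2 c0"
      using pos[OF c0'] by (simp add: w0_def)
    ultimately show ?thesis by (auto simp: mult_nonpos_nonneg)
  qed
  have Z0: "Z r = 0" if r: "a \<le> r" "r \<le> b" for r
  proof -
    have "Z r \<le> Z a"
      by (rule DERIV_nonpos_imp_decreasing_open[OF r(1)])
        (use dZ dZ_nonpos r in \<open>force intro: continuous_on_subset[OF contZ]\<close>)+
    moreover have "Z b \<le> Z r"
      by (rule DERIV_nonpos_imp_decreasing_open[OF r(2)])
        (use dZ dZ_nonpos r in \<open>force intro: continuous_on_subset[OF contZ]\<close>)+
    ultimately show ?thesis by (simp add: Z_def J0 Tz zero)
  qed
  \<comment> \<open>On this strip both \<open>G > 0\<close>, so that \<open>Z' = 0\<close> yields
    proportionality, and \<open>v2 > v1\<close>, which proportionality will contradict.\<close>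
  define d where "d = min (min e e2) (b - a)"
  have proportional: "v2 r = w0 * v1 r" if r: "a < r" "r < a + d" for r
  proof -
    have r': "a < r" "r < b" using r by (auto simp: d_def)
    have "(Z has_real_derivative 0) (at r)"
    proof (rule has_field_derivative_transform_within_open[where S = "{a<..<b}" and f = "\<lambda>_. 0"])
      show "0 = Z x" if "x \<in> {a<..<b}" for x using Z0[of x] that by simp
    qed (use r' in auto)
    then have "H r * ((w0 * v1 r) powr (p + 1) - v2 r powr (p + 1)) = 0"
      using dZ[OF r'] DERIV_unique by blast
    moreover have "H r \<noteq> 0"
    proof -
      have "r < a + e" using r(2) by (auto simp: d_def)
      then show ?thesis using H_eq_0[OF r'(1)] e(2)[of r] r(1) by simp
    qed
    ultimately have "(w0 * v1 r) powr (p + 1) = v2 r powr (p + 1)" by simp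
    then show ?thesis
      using powr_less_mono2[of "p + 1" "w0 * v1 r" "v2 r"] powr_less_mono2[of "p + 1" "v2 r" "w0 * v1 r"]
        w0 pos[OF r'] \<open>p > 1\<close> by (cases "w0 * v1 r" "v2 r" rule: linorder_cases) auto
  qed
  define r where "r = a + d / 2"
  have "d > 0" using e(1) e2(1) \<open>a < b\<close> by (simp add: d_def)
  moreover have "d \<le> b - a" "d \<le> e2" by (auto simp: d_def)
  ultimately have r: "a < r" "r < a + d" "r < b" "r < a + e2" unfolding r_def by linarith+
  have W0: "W x = 0" if x: "x \<in> {a<..<a + d}" for x
  proof -
    have x': "a < x" "x < a + d" "x < b" using x by (auto simp: d_def)
    have "((\<lambda>r. w0 * v1 r) has_real_derivative y2 x) (at x)"
      using d2(1)[OF x'(1,3)]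
      by (rule has_field_derivative_transform_within_open[where S = "{a<..<a + d}"]) (use x proportional in auto)
    moreover have "((\<lambda>r. w0 * v1 r) has_real_derivative w0 * y1 x) (at x)"
      using d1(1)[OF x'(1,3)] by (auto intro!: derivative_eq_intros)
    ultimately have "y2 x = w0 * y1 x" using DERIV_unique by blast
    then show ?thesis using proportional[OF x'(1,2)] by (simp add: W_def)
  qed
  \<comment> \<open>Proportional solutions have \<open>W = 0\<close>, hence \<open>W' = 0\<close>,
    and then the factor \<open>v1 powr (p - 1) - v2 powr (p - 1)\<close> of \<open>W'\<close> must
    vanish.\<close>
  have "(W has_real_derivative 0) (at r)"
  proof (rule has_field_derivative_transform_within_open[where S = "{a<..<a + d}" and f = "\<lambda>_. 0"])
    show "0 = W x" if "x \<in> {a<..<a + d}" for x using W0[OF that] by simp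
  qed (use r in auto)
  then have "r powr (1 - p) * (v2 r * v1 r powr p - v1 r * v2 r powr p) = 0"
    using dW[OF r(1,3)] DERIV_unique by blast
  then have "v1 r powr (p - 1) = v2 r powr (p - 1)"
    using pw[OF r(1,3)] pos[OF r(1,3)] r \<open>0 < a\<close> by simp
  moreover have "v1 r powr (p - 1) < v2 r powr (p - 1)"
    using e2(2)[of r] r pos[OF r(1,3)] \<open>p > 1\<close> by (intro powr_less_mono2) auto
  ultimately show False by simp
qed

section \<open>Shooting\<close>

text \<open>Clipping the power at \<open>0\<close> and \<open>R\<close> makes the force globally Lipschitz; solutions with
  values in \<open>[0, R]\<close> are unaffected.\<close>

definition clip_pow :: "real \<Rightarrow> real \<Rightarrow> real \<Rightarrow> real" where
  "clip_pow p R x = max 0 (min x R) powr p"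

section \<open>Lipschitz bounds for the clipped force\<close>

lemma powr_diff_le:
  fixes p R x y :: real
  assumes "p > 1" "0 \<le> x" "x \<le> y" "y \<le> R"
  shows "y powr p - x powr p \<le> p * R powr (p - 1) * (y - x)"
proof (cases "x = y")
  case False
  then have "x < y" using assms by simp
  have cont: "continuous_on {x..y} (\<lambda>z. z powr p)"
    using assms by (intro continuous_on_powr' continuous_on_const continuous_on_id) auto
  have d: "((\<lambda>z. z powr p) has_real_derivative p * z powr (p - 1)) (at z)" if "x < z" for z
    using that assms by (intro has_real_derivative_powr) auto
  obtain l z where z: "x < z" "z < y" "((\<lambda>z. z powr p) has_real_derivative l) (at z)"
      "y powr p - x powr p = (y - x) * l"
    using MVT[OF \<open>x < y\<close> cont] d by (meson real_differentiable_def)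
  then have "l = p * z powr (p - 1)"
    using d DERIV_unique by blast
  moreover have "z powr (p - 1) \<le> R powr (p - 1)"
    using z assms by (intro powr_mono2) auto
  ultimately show ?thesis
    using z(4) assms by (simp add: mult.commute mult_left_mono)
qed simp

lemma clip_pow_lipschitz:
  assumes "p > 1" "R \<ge> 0"
  shows "\<bar>clip_pow p R x - clip_pow p R y\<bar> \<le> p * R powr (p - 1) * \<bar>x - y\<bar>"
proof (induction x y rule: linorder_wlog)
  case (le x y)
  define c where "c x = max 0 (min x R)" for x
  have c: "0 \<le> c x" "c x \<le> c y" "c y \<le> R" "c y - c x \<le> y - x"
    using le assms by (auto simp: c_def)
  have "\<bar>clip_pow p R x - clip_pow p R y\<bar> = c y powr p - c x powr p"
    using c powr_mono2[of p "c x" "c y"] assms by (simp add: clip_pow_def c_def)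
  also have "\<dots> \<le> p * R powr (p - 1) * (c y - c x)"
    using c assms by (intro powr_diff_le) auto
  also have "\<dots> \<le> p * R powr (p - 1) * \<bar>x - y\<bar>"
    using c le assms by (intro mult_left_mono) auto
  finally show ?case .
next
  case (sym x y)
  then show ?case by (simp add: abs_minus_commute)
qed

lemma clip_pow_nonneg: "clip_pow p R x \<ge> 0"
  by (simp add: clip_pow_def)

lemma clip_pow_le: "p > 0 \<Longrightarrow> 0 \<le> x \<Longrightarrow> 0 \<le> R \<Longrightarrow> clip_pow p R x \<le> x powr p"
  unfolding clip_pow_def by (intro powr_mono2) auto

lemma clip_pow_eq: "0 \<le> x \<Longrightarrow> x \<le> R \<Longrightarrow> clip_pow p R x = x powr p"
  by (simp add: clip_pow_def max_def min_def)

text \<open>Where a solution is nonpositive its equation becomes the linear one,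
  \<open>v'' = - lam v\<close>; this decides what happens after a first zero.\<close>

lemma clip_pow_neg: "x \<le> 0 \<Longrightarrow> 0 \<le> R \<Longrightarrow> clip_pow p R x = 0"
  by (simp add: clip_pow_def max_def min_def)

definition force_clipped :: "real \<Rightarrow> real \<Rightarrow> real \<Rightarrow> real \<Rightarrow> real \<Rightarrow> real" where
  "force_clipped lam p R r x = lam * x + r powr (1 - p) * clip_pow p R x"

lemma force_clipped_lipschitz:
  assumes "p > 1" "R \<ge> 0" "lam > 0" "0 < a" "a \<le> r"
  shows "\<bar>force_clipped lam p R r x - force_clipped lam p R r x'\<bar>
    \<le> (lam + a powr (1 - p) * (p * R powr (p - 1))) * \<bar>x - x'\<bar>"
proof -
  have "r powr (1 - p) \<le> a powr (1 - p)"
    using assms by (intro powr_mono2') auto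
  then have "r powr (1 - p) * \<bar>clip_pow p R x - clip_pow p R x'\<bar>
      \<le> a powr (1 - p) * (p * R powr (p - 1) * \<bar>x - x'\<bar>)"
    using assms by (intro mult_mono clip_pow_lipschitz) auto
  moreover have "force_clipped lam p R r x - force_clipped lam p R r x'
      = lam * (x - x') + r powr (1 - p) * (clip_pow p R x - clip_pow p R x')"
    by (simp add: force_clipped_def algebra_simps)
  then have "\<bar>force_clipped lam p R r x - force_clipped lam p R r x'\<bar>
      \<le> lam * \<bar>x - x'\<bar> + r powr (1 - p) * \<bar>clip_pow p R x - clip_pow p R x'\<bar>"
    using abs_triangle_ineq[of "lam * (x - x')" "r powr (1 - p) * (clip_pow p R x - clip_pow p R x')"] assms
    by (simp add: abs_mult)
  ultimately show ?thesis by (simp add: algebra_simps)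
qed

lemma force_clipped_continuous:
  assumes "p > 1" "0 < a"
  shows "continuous_on ({a..b} \<times> UNIV) (\<lambda>(r, x). force_clipped lam p R r x)"
  unfolding force_clipped_def clip_pow_def case_prod_unfold
  by (intro continuous_on_add continuous_on_mult continuous_on_const continuous_on_powr'
      continuous_on_fst continuous_on_snd continuous_on_id continuous_on_max continuous_on_min)
    (use assms in auto)

lemma force_clipped_nonneg: "lam > 0 \<Longrightarrow> 0 \<le> x \<Longrightarrow> force_clipped lam p R r x \<ge> 0"
  by (simp add: force_clipped_def clip_pow_nonneg)

text \<open>\<open>s\<close> is free in the last three assumptions, so a whole family of solutions
  with initial slope \<open>s\<close> is fixed, each on all of \<open>{a..b}\<close> thanks to the
  clipping. \<open>short\<close> puts \<open>lam\<close> below the first Dirichlet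
  eigenvalue.\<close>

locale shooting =
  fixes lam p a b R :: real and V Y :: "real \<Rightarrow> real \<Rightarrow> real"
  assumes a_pos: "0 < a" and ab: "a < b" and lam_pos: "lam > 0" and p_gt: "p > 1" and R_nonneg: "R \<ge> 0"
    and short: "sqrt lam * (b - a) < pi"
    and sol: "ode_sol (force_clipped lam p R) a b (V s) (Y s)"
    and V_a: "V s a = 0" and Y_a: "Y s a = s"
begin

abbreviation "F \<equiv> force_clipped lam p R"

definition "L = lam + a powr (1 - p) * (p * R powr (p - 1))"

lemma L_nonneg: "L \<ge> 0"
  using lam_pos p_gt by (simp add: L_def)

lemma F_lipschitz: "r \<in> {a..b} \<Longrightarrow> \<bar>F r x - F r x'\<bar> \<le> L * \<bar>x - x'\<bar>"
  using force_clipped_lipschitz[OF p_gt R_nonneg lam_pos a_pos, of r x x'] by (simp add: L_def)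

lemmas V_deriv = ode_solD(1)[OF sol] and Y_deriv = ode_solD(2)[OF sol]
lemmas V_deriv' = ode_sol_interior(1)[OF sol] and Y_deriv' = ode_sol_interior(2)[OF sol]
lemmas V_cont = ode_sol_continuous(1)[OF sol] and Y_cont = ode_sol_continuous(2)[OF sol]

lemma solution_is_V:
  assumes "ode_sol F a b v y" "v a = 0" "r \<in> {a..b}"
  shows "v r = V (y a) r" "y r = Y (y a) r"
  using ode_sol_unique[OF assms(1) sol L_nonneg F_lipschitz, of a "y a" r] assms ab V_a Y_a by auto

text \<open>Equal value and slope at one point propagate back to \<open>a\<close>, where the slopes
  are \<open>s\<close> and \<open>s'\<close>. This is the source of transversality.\<close>

lemma no_double_contact:
  assumes "r \<in> {a..b}" "V s r = V s' r" "Y s r = Y s' r"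
  shows "s = s'"
  using ode_sol_unique(2)[OF sol sol L_nonneg F_lipschitz assms(1-3), of a] ab Y_a by auto

lemma V_0: "r \<in> {a..b} \<Longrightarrow> V 0 r = 0" "r \<in> {a..b} \<Longrightarrow> Y 0 r = 0"
proof -
  have "ode_sol F a b (\<lambda>_. 0) (\<lambda>_. 0)"
    using R_nonneg by (simp add: ode_sol_def force_clipped_def clip_pow_neg)
  from solution_is_V[OF this] show "r \<in> {a..b} \<Longrightarrow> V 0 r = 0" "r \<in> {a..b} \<Longrightarrow> Y 0 r = 0" by simp_all
qed

text \<open>The square root of the Gronwall factor: a Lipschitz constant in the slope, uniform over
  the interval.\<close>

definition "C = sqrt (exp ((1 + L) * (b - a)))"

lemma C_pos: "C > 0"
  by (simp add: C_def)

lemma dependence: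
  assumes "r \<in> {a..b}"
  shows "\<bar>V s r - V s' r\<bar> \<le> C * \<bar>s - s'\<bar>" "\<bar>Y s r - Y s' r\<bar> \<le> C * \<bar>s - s'\<bar>"
proof -
  have "(V s r - V s' r)\<^sup>2 + (Y s r - Y s' r)\<^sup>2 \<le> (s - s')\<^sup>2 * exp ((1 + L) * \<bar>r - a\<bar>)"
    using ode_sol_gronwall[OF sol sol L_nonneg F_lipschitz, of a r s s'] assms ab by (simp add: V_a Y_a)
  also have "\<dots> \<le> (s - s')\<^sup>2 * exp ((1 + L) * (b - a))"
    using assms L_nonneg by (intro mult_left_mono) auto
  also have "\<dots> = (C * \<bar>s - s'\<bar>)\<^sup>2"
    by (simp add: C_def power_mult_distrib)
  finally have *: "(V s r - V s' r)\<^sup>2 + (Y s r - Y s' r)\<^sup>2 \<le> (C * \<bar>s - s'\<bar>)\<^sup>2" .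
  have "(V s r - V s' r)\<^sup>2 \<le> (C * \<bar>s - s'\<bar>)\<^sup>2" "(Y s r - Y s' r)\<^sup>2 \<le> (C * \<bar>s - s'\<bar>)\<^sup>2"
    using * by (smt (verit) zero_le_power2)+
  then show "\<bar>V s r - V s' r\<bar> \<le> C * \<bar>s - s'\<bar>" "\<bar>Y s r - Y s' r\<bar> \<le> C * \<bar>s - s'\<bar>"
    using C_pos by (simp_all add: abs_le_square_iff[symmetric])
qed

lemma joint_limit:
  assumes "s \<longlonglongrightarrow> s0" "r \<longlonglongrightarrow> r0" "\<And>n. r n \<in> {a..b}" "r0 \<in> {a..b}"
  shows "(\<lambda>n. V (s n) (r n)) \<longlonglongrightarrow> V s0 r0" "(\<lambda>n. Y (s n) (r n)) \<longlonglongrightarrow> Y s0 r0"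
proof -
  have *: "(\<lambda>n. C * \<bar>s n - s0\<bar>) \<longlonglongrightarrow> 0"
    using tendsto_mult[OF tendsto_const tendsto_rabs[OF tendsto_diff[OF assms(1) tendsto_const[of s0]]]]
    by simp
  have "(\<lambda>n. V (s n) (r n) - V s0 (r n)) \<longlonglongrightarrow> 0" "(\<lambda>n. Y (s n) (r n) - Y s0 (r n)) \<longlonglongrightarrow> 0"
    by (rule Lim_null_comparison[OF _ *], use dependence assms(3) in auto)+
  moreover have "(\<lambda>n. V s0 (r n)) \<longlonglongrightarrow> V s0 r0" "(\<lambda>n. Y s0 (r n)) \<longlonglongrightarrow> Y s0 r0"
    using continuous_on_tendsto_compose[OF V_cont assms(2,4)] continuous_on_tendsto_compose[OF Y_cont assms(2,4)]
      assms(3) by (simp_all add: always_eventually)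
  ultimately show "(\<lambda>n. V (s n) (r n)) \<longlonglongrightarrow> V s0 r0" "(\<lambda>n. Y (s n) (r n)) \<longlonglongrightarrow> Y s0 r0"
    using tendsto_add by fastforce+
qed

section \<open>Zeros and bounds of shooting solutions\<close>

lemma V_pos_near_a:
  assumes "s > 0"
  obtains e where "e > 0" "\<And>t. a < t \<Longrightarrow> t < a + e \<Longrightarrow> t \<le> b \<Longrightarrow> V s t > 0"
  using pos_right_of_zero[OF V_deriv[of a s]] V_a Y_a assms ab
  by (metis atLeastAtMost_iff less_imp_le order_refl)

text \<open>A zero reached from above has slope at most \<open>0\<close>, and slope \<open>0\<close>
  would be a double contact with the trivial solution \<open>V 0\<close>.\<close>

lemma Y_neg_at_zero:
  assumes "s > 0" "a < z" "z \<le> b" "V s z = 0" "\<And>t. a < t \<Longrightarrow> t < z \<Longrightarrow> V s t > 0"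
  shows "Y s z < 0"
proof (rule ccontr)
  assume "\<not> Y s z < 0"
  moreover have "Y s z \<noteq> 0"
    using no_double_contact[of z s 0] V_0[of z] assms by auto
  ultimately have "Y s z > 0" by simp
  then obtain e where e: "e > 0" "\<And>h. 0 < h \<Longrightarrow> z - h \<in> {a..b} \<Longrightarrow> h < e \<Longrightarrow> V s (z - h) < V s z"
    using has_real_derivative_pos_inc_left[OF V_deriv[of z s]] assms by auto
  define h where "h = min e (z - a) / 2"
  have h: "0 < h" "h < e" "a < z - h"
    using e(1) assms(2) by (auto simp: h_def min_def field_simps)
  then have "V s (z - h) < 0"
    using e(2)[of h] assms(3,4) by auto
  then show False using assms(5)[of "z - h"] h by simp
qed

text \<open>Below zero the equation is linear with half-period \<open>pi / sqrt lam\<close>, longer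
  than the interval, so there is no return to zero up to \<open>b\<close>. Hence the sign of
  \<open>V s b\<close> alone decides positivity inside.\<close>

lemma V_neg_after_zero:
  assumes s: "s > 0" and z: "a < z" "z < b" "V s z = 0" "\<And>t. a < t \<Longrightarrow> t < z \<Longrightarrow> V s t > 0"
  shows "V s b < 0"
proof (rule ccontr)
  assume nb: "\<not> V s b < 0"
  have Yz: "Y s z < 0"
    using Y_neg_at_zero[OF s z(1) _ z(3,4)] z(2) by simp
  have sub: "{z..b} \<subseteq> {a..b}" using z by auto
  have dz: "((\<lambda>t. - V s t) has_real_derivative - Y s z) (at z within {z..b})"
    using z by (intro DERIV_minus DERIV_subset[OF V_deriv sub]) auto
  obtain e where e: "e > 0" "\<And>t. z < t \<Longrightarrow> t < z + e \<Longrightarrow> t \<le> b \<Longrightarrow> - V s t > 0"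
    using pos_right_of_zero[OF dz] z(3) Yz by auto
  have "continuous_on {z..b} (\<lambda>t. - V s t)"
    by (intro continuous_on_minus continuous_on_subset[OF V_cont sub])
  then obtain z2 where z2: "z < z2" "z2 \<le> b" "- V s z2 = 0" "\<And>t. z < t \<Longrightarrow> t < z2 \<Longrightarrow> - V s t > 0"
    using first_zero[of z b "\<lambda>t. - V s t" e b] e z(2) nb by auto
  define k where "k = sqrt lam"
  have k: "k > 0" "k\<^sup>2 = lam" using lam_pos by (auto simp: k_def)
  \<comment> \<open>The Wronskian with \<open>sin (k (t - z))\<close> is constant while
    \<open>V s\<close> is negative; comparing \<open>z\<close> with \<open>z2\<close> would force
    \<open>Y s z2 = 0\<close>.\<close>
  define W where "W t = Y s t * sin (k * (t - z)) - V s t * (k * cos (k * (t - z)))" for t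
  have "W z2 = W z"
  proof (rule DERIV_isconst_end[OF z2(1)])
    show "continuous_on {z..z2} W"
      unfolding W_def using z z2
      by (intro continuous_intros continuous_on_subset[OF V_cont] continuous_on_subset[OF Y_cont]) auto
    fix t assume t: "z < t" "t < z2"
    have F: "F t (V s t) = k\<^sup>2 * V s t"
      using z2(4)[OF t] R_nonneg by (simp add: force_clipped_def clip_pow_neg k)
    have t': "a < t" "t < b" using t z z2 by auto
    show "(W has_real_derivative 0) (at t)"
      unfolding W_def using V_deriv'[OF t', of s] Y_deriv'[OF t', of s]
      by (auto intro!: derivative_eq_intros simp: F power2_eq_square)
  qed
  then have "Y s z2 * sin (k * (z2 - z)) = 0"
    using z(3) z2(3) by (simp add: W_def)
  moreover have "k * (z2 - z) \<le> k * (b - a)"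
    using k z z2 by (intro mult_left_mono) auto
  then have "k * (z2 - z) < pi" using short unfolding k_def by linarith
  then have "sin (k * (z2 - z)) > 0"
    using k(1) z2(1) by (intro sin_gt_zero) auto
  ultimately have "Y s z2 = 0" by simp
  then have "s = 0"
    using no_double_contact[of z2 s 0] V_0[of z2] z z2 by auto
  then show False using s by simp
qed

lemma V_pos_interior:
  assumes s: "s > 0" and "V s b \<ge> 0" and r: "a < r" "r < b"
  shows "V s r > 0"
proof (rule ccontr)
  assume "\<not> V s r > 0"
  then have nr: "V s r \<le> 0" by simp
  obtain e where e: "e > 0" "\<And>t. a < t \<Longrightarrow> t < a + e \<Longrightarrow> t \<le> b \<Longrightarrow> V s t > 0"
    using V_pos_near_a[OF s] by blast
  obtain z where "a < z" "z \<le> r" "V s z = 0" "\<And>t. a < t \<Longrightarrow> t < z \<Longrightarrow> V s t > 0"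
    using first_zero[OF V_cont[of s] e r(1) less_imp_le[OF r(2)] nr] by blast
  then show False using V_neg_after_zero[OF s, of z] r assms(2) by simp
qed

lemma Y_b_neg: "s > 0 \<Longrightarrow> V s b = 0 \<Longrightarrow> Y s b < 0"
  using Y_neg_at_zero[of s b] V_pos_interior[of s] ab by simp

lemma Y_le:
  assumes "z \<le> b" "a \<le> r" "r \<le> z" "\<And>t. a < t \<Longrightarrow> t < z \<Longrightarrow> V s t > 0"
  shows "Y s r \<le> s"
proof -
  have "Y s r \<le> Y s a"
  proof (rule DERIV_nonpos_imp_decreasing_open[OF assms(2)])
    show "continuous_on {a..r} (Y s)"
      using assms by (intro continuous_on_subset[OF Y_cont]) auto
    fix x assume "a < x" "x < r"
    then show "\<exists>y. (Y s has_real_derivative y) (at x) \<and> y \<le> 0"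
      using Y_deriv'[of x s] force_clipped_nonneg[OF lam_pos, of "V s x" p R x] assms(1,3) assms(4)[of x]
      by (meson less_imp_le neg_le_0_iff_le order_less_le_trans)
  qed
  then show ?thesis by (simp add: Y_a)
qed

text \<open>A positive solution is concave and so stays below its tangent at \<open>a\<close>. This
  lets the slope alone tell whether the clipping is active.\<close>

lemma V_le:
  assumes "z \<le> b" "a \<le> r" "r \<le> z" "\<And>t. a < t \<Longrightarrow> t < z \<Longrightarrow> V s t > 0"
  shows "V s r \<le> s * (r - a)"
proof (cases "r = a")
  case False
  then have "a < r" using assms by simp
  obtain x where "a < x" "x < r" "V s r - V s a = (r - a) * Y s x"
    using mvt_Icc[OF V_deriv[of _ s], of a r] \<open>a < r\<close> assms(1,3) by auto
  moreover have "Y s x \<le> s"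
    using Y_le[of z x s] assms calculation by simp
  ultimately show ?thesis
    using V_a mult_left_mono[of "Y s x" s "r - a"] \<open>a < r\<close> by (simp add: mult.commute)
qed (simp add: V_a)

lemma V_b_continuous: "continuous_on S (\<lambda>s. V s b)"
proof (rule continuous_at_imp_continuous_on, safe)
  fix s
  show "isCont (\<lambda>s. V s b) s"
    unfolding continuous_at_sequentially comp_def using joint_limit(1)[of _ s "\<lambda>_. b" b] ab by auto
qed

text \<open>Deform \<open>V s\<close> from \<open>V 0 = 0\<close> to \<open>V s1\<close>. All contacts of \<open>V s\<close> with \<open>V s2\<close> are transversal and
  none can enter through an end point, so \<open>V s2 - V s\<close> never acquires a second sign change.\<close>

lemma single_crossing:
  assumes s12: "0 < s1" "s1 < s2"
    and pos2: "\<And>r. a < r \<Longrightarrow> r < b \<Longrightarrow> V s2 r > 0" and "V s2 b = 0"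
    and pos_b: "\<And>s. 0 < s \<Longrightarrow> s < s1 \<Longrightarrow> V s b > 0" and "V s1 b = 0"
    and r: "a \<le> r" "r < r'" "r' \<le> b" "V s2 r - V s1 r < 0" "0 < V s2 r' - V s1 r'"
  shows False
proof -
  define D where "D s r = V s2 r - V s r" for s r
  define D' where "D' s r = Y s2 r - Y s r" for s r
  have dD: "(D s has_real_derivative D' s t) (at t within {a..b})" if "t \<in> {a..b}" for s t
    unfolding D_def D'_def using that by (intro DERIV_diff V_deriv)
  have dD': "(D s has_real_derivative D' s t) (at t)" if "a < t" "t < b" for s t
    unfolding D_def D'_def using that by (intro DERIV_diff V_deriv')
  have Da: "D s a = 0" for s by (simp add: D_def V_a)
  \<comment> \<open>The forbidden pattern minus, plus. It is open in \<open>s\<close> and fails at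
    \<open>s = 0\<close>, where \<open>D 0 = V s2 >= 0\<close>; so it fails at the infimum
    \<open>\<sigma>\<close> but holds for slopes arbitrarily close to it.\<close>
  define Q where "Q s \<longleftrightarrow> (\<exists>r r'. a \<le> r \<and> r < r' \<and> r' \<le> b \<and> D s r < 0 \<and> 0 < D s r')" for s
  have Q_open: "\<exists>e>0. \<forall>s'. \<bar>s' - s\<bar> < e \<longrightarrow> Q s'" if Qs: "Q s" for s
  proof -
    obtain r r' where r: "a \<le> r" "r < r'" "r' \<le> b" "D s r < 0" "0 < D s r'"
      using Qs by (auto simp: Q_def)
    define m where "m = min (- D s r) (D s r')"
    have "m > 0" using r by (simp add: m_def)
    have "Q s'" if s': "\<bar>s' - s\<bar> < m / C" for s'
    proof -
      have "C * \<bar>s' - s\<bar> < m" using s' C_pos by (simp add: field_simps)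
      then have "\<bar>V s' r - V s r\<bar> < m" "\<bar>V s' r' - V s r'\<bar> < m"
        using dependence(1)[of r s' s] dependence(1)[of r' s' s] r by auto
      then have "D s' r < 0" "0 < D s' r'"
        by (auto simp: D_def m_def min_def split: if_splits)
      then show ?thesis using r by (auto simp: Q_def)
    qed
    then show ?thesis using \<open>m > 0\<close> C_pos by (intro exI[of _ "m / C"]) auto
  qed
  define S where "S = {s \<in> {0..s1}. Q s}"
  have "s1 \<in> S" using r s12 by (auto simp: S_def Q_def D_def)
  define \<sigma> where "\<sigma> = Inf S"
  have bdd: "bdd_below S" by (auto simp: S_def intro: bdd_belowI[of _ 0])
  have lower: "\<sigma> \<le> s" if "s \<in> S" for s
    unfolding \<sigma>_def using that bdd by (rule cInf_lower)
  have \<sigma>0: "0 \<le> \<sigma>"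
    unfolding \<sigma>_def using \<open>s1 \<in> S\<close> by (intro cInf_greatest) (auto simp: S_def)
  have notQ0: "\<not> Q 0"
  proof
    assume "Q 0"
    then obtain r where r: "a \<le> r" "r \<le> b" "D 0 r < 0" by (auto simp: Q_def)
    moreover have "V s2 r \<ge> 0"
      using pos2[of r] V_a[of s2] assms(4) r by (cases "r = a \<or> r = b") (auto intro: less_imp_le)
    ultimately show False using V_0(1)[of r] by (simp add: D_def)
  qed
  have notQ: "\<not> Q \<sigma>"
  proof
    assume Q: "Q \<sigma>"
    then have "\<sigma> > 0" using notQ0 \<sigma>0 by (cases "\<sigma> = 0") auto
    obtain e where e: "e > 0" "\<And>s'. \<bar>s' - \<sigma>\<bar> < e \<Longrightarrow> Q s'" using Q_open[OF Q] by blast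
    define s' where "s' = \<sigma> - min e \<sigma> / 2"
    have s': "0 \<le> s'" "s' < \<sigma>" "\<bar>s' - \<sigma>\<bar> < e"
      using e(1) \<open>\<sigma> > 0\<close> by (auto simp: s'_def min_def abs_if field_simps)
    then have "s' \<in> S" using e(2)[of s'] lower[OF \<open>s1 \<in> S\<close>] by (auto simp: S_def)
    then show False using lower[of s'] s' by simp
  qed
  have \<sigma>1: "\<sigma> < s1"
    using notQ lower[OF \<open>s1 \<in> S\<close>] \<open>s1 \<in> S\<close> by (cases "\<sigma> = s1") (auto simp: S_def)
  have "\<exists>s. s \<in> S \<and> \<bar>s - \<sigma>\<bar> < 1 / (real n + 1)" for n
  proof -
    have "\<exists>s\<in>S. s < \<sigma> + 1 / (real n + 1)"
      using \<open>s1 \<in> S\<close> bdd cInf_less_iff[of S "\<sigma> + 1 / (real n + 1)"] by (auto simp: \<sigma>_def)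
    then show ?thesis using lower by (force simp: abs_if)
  qed
  then obtain s where s: "\<And>n. s n \<in> S" "\<And>n. \<bar>s n - \<sigma>\<bar> < 1 / (real n + 1)" by metis
  have s_lim: "s \<longlonglongrightarrow> \<sigma>"
  proof (rule LIM_zero_cancel, rule Lim_null_comparison)
    show "(\<lambda>n. 1 / (real n + 1)) \<longlonglongrightarrow> 0"
      using LIMSEQ_inverse_real_of_nat by (simp add: inverse_eq_divide add.commute)
  qed (use s(2) in \<open>auto intro: less_imp_le always_eventually\<close>)
  have "\<exists>r r'. a \<le> r \<and> r < r' \<and> r' \<le> b \<and> D (s n) r < 0 \<and> 0 < D (s n) r'" for n
    using s(1)[of n] by (simp add: S_def Q_def)
  \<comment> \<open>Witnesses of the pattern for slopes tending to \<open>\<sigma>\<close>; a common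
    subsequence converges to \<open>\<rho> \<le> \<rho>'\<close>, and each possible limit position
    is excluded below.\<close>
  then obtain x x' where x: "\<And>n. a \<le> x n" "\<And>n. x n < x' n" "\<And>n. x' n \<le> b"
      "\<And>n. D (s n) (x n) < 0" "\<And>n. 0 < D (s n) (x' n)" by metis
  have "compact ({a..b} \<times> {a..b})" by (intro compact_Times compact_Icc)
  moreover have "(x n, x' n) \<in> {a..b} \<times> {a..b}" for n
    using x(1-3)[of n] by auto
  ultimately obtain l f where lf: "l \<in> {a..b} \<times> {a..b}" "strict_mono f" "((\<lambda>n. (x n, x' n)) \<circ> f) \<longlonglongrightarrow> l"
    unfolding compact_def by (metis (no_types, lifting))
  obtain \<rho> \<rho>' where l: "l = (\<rho>, \<rho>')" by (cases l)
  have \<rho>: "\<rho> \<in> {a..b}" "\<rho>' \<in> {a..b}" using lf(1) by (auto simp: l)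
  have xl: "(\<lambda>n. x (f n)) \<longlonglongrightarrow> \<rho>" "(\<lambda>n. x' (f n)) \<longlonglongrightarrow> \<rho>'"
    using tendsto_fst[OF lf(3)] tendsto_snd[OF lf(3)] by (simp_all add: l comp_def)
  have sl: "(\<lambda>n. s (f n)) \<longlonglongrightarrow> \<sigma>"
    using LIMSEQ_subseq_LIMSEQ[OF s_lim lf(2)] by (simp add: comp_def)
  have lim: "(\<lambda>n. D (s (f n)) (t n)) \<longlonglongrightarrow> D \<sigma> t0" "(\<lambda>n. D' (s (f n)) (t n)) \<longlonglongrightarrow> D' \<sigma> t0"
    if "t \<longlonglongrightarrow> t0" "\<And>n. t n \<in> {a..b}" "t0 \<in> {a..b}" for t t0
    unfolding D_def D'_def using that
    by (intro tendsto_diff joint_limit sl tendsto_const; simp)+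
  have \<rho>_le: "\<rho> \<le> \<rho>'"
    using xl by (rule LIMSEQ_le) (use x(2) less_imp_le in blast)
  have x_in: "x n \<in> {a..b}" "x' n \<in> {a..b}" for n
    using x(1-3)[of n] by auto
  have D\<rho>: "D \<sigma> \<rho> \<le> 0"
    using lim(1)[OF xl(1) x_in(1) \<rho>(1)] x(4) by (intro LIMSEQ_le_const2) (auto intro: less_imp_le)
  have D\<rho>': "D \<sigma> \<rho>' \<ge> 0"
    using lim(1)[OF xl(2) x_in(2) \<rho>(2)] x(5) by (intro LIMSEQ_le_const) (auto intro: less_imp_le)

  \<comment> \<open>Negative values accumulating at \<open>a\<close> would give
    \<open>D' \<sigma> a \<le> 0\<close>, but this slope is
    \<open>s2 - \<sigma> > 0\<close>.\<close>
  have "\<rho> \<noteq> a"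
  proof
    assume "\<rho> = a"
    have "\<exists>t. a < t \<and> t < x n \<and> D' (s n) t < 0" for n
    proof -
      have "x n \<noteq> a" using x(4)[of n] Da by auto
      then have ax: "a < x n" using x(1)[of n] by simp
      obtain t where t: "a < t" "t < x n" "D (s n) (x n) - D (s n) a = (x n - a) * D' (s n) t"
        using mvt_Icc[OF dD, of a "x n" "s n"] ax x_in(1)[of n] by auto
      then have "(x n - a) * D' (s n) t < 0" using x(4)[of n] Da by simp
      then show ?thesis using t ax by (auto simp: mult_less_0_iff)
    qed
    then obtain t where t: "\<And>n. a < t n" "\<And>n. t n < x n" "\<And>n. D' (s n) (t n) < 0" by metis
    have "(\<lambda>n. t (f n)) \<longlonglongrightarrow> a"
      using xl(1) unfolding \<open>\<rho> = a\<close>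
      by (rule tendsto_sandwich[OF _ _ tendsto_const, rotated 2]) (use t in \<open>auto intro!: always_eventually less_imp_le\<close>)
    moreover have "t n \<in> {a..b}" for n using t(1,2)[of n] x_in(1)[of n] by auto
    ultimately have "D' \<sigma> a \<le> 0"
      using lim(2)[of "\<lambda>n. t (f n)" a] t(3) ab by (intro LIMSEQ_le_const2) (auto intro: less_imp_le)
    then show False using \<sigma>1 s12 by (simp add: D'_def Y_a)
  qed
  have eq_case: "D' \<sigma> \<rho> \<ge> 0" if "\<rho> = \<rho>'"
  proof -
    have "\<exists>t. x n < t \<and> t < x' n \<and> D' (s n) t > 0" for n
    proof -
      obtain t where t: "x n < t" "t < x' n" "D (s n) (x' n) - D (s n) (x n) = (x' n - x n) * D' (s n) t"
        using mvt_Icc[OF dD, of "x n" "x' n" "s n"] x(2)[of n] x_in[of n] by auto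
      then have "(x' n - x n) * D' (s n) t > 0" using x(4,5)[of n] by simp
      then show ?thesis using t by (auto simp: zero_less_mult_iff)
    qed
    then obtain t where t: "\<And>n. x n < t n" "\<And>n. t n < x' n" "\<And>n. D' (s n) (t n) > 0" by metis
    have "(\<lambda>n. t (f n)) \<longlonglongrightarrow> \<rho>"
      by (rule tendsto_sandwich[OF _ _ xl(1) xl(2)[folded that]]) (use t in \<open>auto intro!: always_eventually less_imp_le\<close>)
    moreover have "t n \<in> {a..b}" for n using t(1,2)[of n] x_in[of n] by auto
    ultimately show ?thesis
      using lim(2)[of "\<lambda>n. t (f n)" \<rho>] t(3) \<rho> by (intro LIMSEQ_le_const) (auto intro: less_imp_le)
  qed
  \<comment> \<open>For \<open>\<sigma> > 0\<close> the assumption \<open>pos_b\<close> makes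
    \<open>D \<sigma>\<close> negative at \<open>b\<close>. For \<open>\<sigma> = 0\<close> the
    difference is \<open>V s2\<close> itself, which reaches \<open>b\<close> with negative
    slope.\<close>
  have "\<rho>' \<noteq> b"
  proof
    assume "\<rho>' = b"
    have "\<sigma> = 0"
    proof (rule ccontr)
      assume "\<sigma> \<noteq> 0"
      then have "V \<sigma> b > 0" using \<sigma>0 \<sigma>1 by (intro pos_b) auto
      then show False using D\<rho>' \<open>\<rho>' = b\<close> assms(4) by (simp add: D_def)
    qed
    then have "V s2 \<rho> \<le> 0" using D\<rho> V_0(1)[OF \<rho>(1)] by (simp add: D_def)
    then have "\<rho> = b" using pos2[of \<rho>] \<rho> \<open>\<rho> \<noteq> a\<close> by force
    then have "D' \<sigma> b \<ge> 0" using eq_case \<open>\<rho>' = b\<close> by simp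
    then show False
      using Y_b_neg[of s2] s12 assms(4) V_0(2)[of b] ab \<open>\<sigma> = 0\<close> by (simp add: D'_def)
  qed
  then have int: "a < \<rho>" "\<rho> < b" "a < \<rho>'" "\<rho>' < b"
    using \<rho> \<rho>_le \<open>\<rho> \<noteq> a\<close> by auto
  have simple: "D' \<sigma> t \<noteq> 0" if "D \<sigma> t = 0" "t \<in> {a..b}" for t
    using no_double_contact[of t s2 \<sigma>] that \<sigma>1 s12 by (auto simp: D_def D'_def)
  have QI: False if "a \<le> t" "t < t'" "t' \<le> b" "D \<sigma> t < 0" "0 < D \<sigma> t'" for t t'
    using notQ that by (auto simp: Q_def)
  \<comment> \<open>Otherwise \<open>D \<sigma>\<close> would be nonpositive right of
    \<open>\<rho>\<close> and touch zero from below at \<open>\<rho>'\<close>: a double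
    contact.\<close>
  have "D \<sigma> \<rho> = 0"
  proof (rule ccontr)
    assume "D \<sigma> \<rho> \<noteq> 0"
    then have neg: "D \<sigma> \<rho> < 0" using D\<rho> by simp
    then have "\<rho> < \<rho>'" using D\<rho>' \<rho>_le by (cases "\<rho> = \<rho>'") auto
    have le: "D \<sigma> t \<le> 0" if "\<rho> < t" "t \<le> b" for t
      using QI[of \<rho> t] neg \<rho> that by force
    have "D \<sigma> \<rho>' = 0" using le[of \<rho>'] \<open>\<rho> < \<rho>'\<close> D\<rho>' \<rho> by auto
    have "D' \<sigma> \<rho>' = 0"
    proof (rule DERIV_local_max[OF dD'[OF int(3,4)], of "min (\<rho>' - \<rho>) (b - \<rho>')"])
      show "\<forall>y. \<bar>\<rho>' - y\<bar> < min (\<rho>' - \<rho>) (b - \<rho>') \<longrightarrow> D \<sigma> y \<le> D \<sigma> \<rho>'"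
        using le \<open>D \<sigma> \<rho>' = 0\<close> by (auto simp: abs_if split: if_splits)
    qed (use \<open>\<rho> < \<rho>'\<close> int in auto)
    then show False using simple[of \<rho>'] \<open>D \<sigma> \<rho>' = 0\<close> \<rho> by simp
  qed
  have "D \<sigma> \<rho>' = 0"
  proof (rule ccontr)
    assume "D \<sigma> \<rho>' \<noteq> 0"
    then have neg: "D \<sigma> \<rho>' > 0" using D\<rho>' by simp
    then have "\<rho> < \<rho>'" using D\<rho> \<rho>_le by (cases "\<rho> = \<rho>'") auto
    have le: "D \<sigma> t \<ge> 0" if "a \<le> t" "t < \<rho>'" for t
      using QI[of t \<rho>'] neg \<rho> that by force
    have "D' \<sigma> \<rho> = 0"
    proof (rule DERIV_local_min[OF dD'[OF int(1,2)], of "min (\<rho>' - \<rho>) (\<rho> - a)"])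
      show "\<forall>y. \<bar>\<rho> - y\<bar> < min (\<rho>' - \<rho>) (\<rho> - a) \<longrightarrow> D \<sigma> \<rho> \<le> D \<sigma> y"
        using le \<open>D \<sigma> \<rho> = 0\<close> by (auto simp: abs_if split: if_splits)
    qed (use \<open>\<rho> < \<rho>'\<close> int in auto)
    then show False using simple[of \<rho>] \<open>D \<sigma> \<rho> = 0\<close> \<rho> by simp
  qed
  \<comment> \<open>An upward crossing would itself be the pattern \<open>Q \<sigma>\<close>, so
    every interior zero is crossed downwards.\<close>
  have neg: "D' \<sigma> t < 0" if t: "a < t" "t < b" "D \<sigma> t = 0" for t
  proof (rule ccontr)
    assume "\<not> D' \<sigma> t < 0"
    then have p: "D' \<sigma> t > 0" using simple[of t] t by force
    obtain d where d: "d > 0" "\<And>h. 0 < h \<Longrightarrow> h < d \<Longrightarrow> D \<sigma> t < D \<sigma> (t + h)"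
      using DERIV_pos_inc_right[OF dD'[OF t(1,2)] p] by blast
    obtain d' where d': "d' > 0" "\<And>h. 0 < h \<Longrightarrow> h < d' \<Longrightarrow> D \<sigma> (t - h) < D \<sigma> t"
      using DERIV_pos_inc_left[OF dD'[OF t(1,2)] p] by blast
    define h where "h = min (min d d') (min (t - a) (b - t)) / 2"
    have "h > 0" using d(1) d'(1) t by (simp add: h_def)
    moreover have "2 * h \<le> d" "2 * h \<le> d'" "2 * h \<le> t - a" "2 * h \<le> b - t" by (auto simp: h_def)
    ultimately show False
      using QI[of "t - h" "t + h"] d(2)[of h] d'(2)[of h] t by auto
  qed
  show False
  proof (cases "\<rho> = \<rho>'")
    case True
    then show False using neg[of \<rho>] eq_case int \<open>D \<sigma> \<rho> = 0\<close> by simp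
  next
    case False
    then have "\<rho> < \<rho>'" using \<rho>_le by simp
    obtain d where d: "d > 0" "\<And>h. 0 < h \<Longrightarrow> h < d \<Longrightarrow> D \<sigma> (\<rho> + h) < D \<sigma> \<rho>"
      using DERIV_neg_dec_right[OF dD'[OF int(1,2)] neg[OF int(1,2) \<open>D \<sigma> \<rho> = 0\<close>]] by blast
    obtain d' where d': "d' > 0" "\<And>h. 0 < h \<Longrightarrow> h < d' \<Longrightarrow> D \<sigma> \<rho>' < D \<sigma> (\<rho>' - h)"
      using DERIV_neg_dec_left[OF dD'[OF int(3,4)] neg[OF int(3,4) \<open>D \<sigma> \<rho>' = 0\<close>]] by blast
    \<comment> \<open>A third of the gap keeps \<open>\<rho> + h\<close> left of
      \<open>\<rho>' - h\<close>. Two downward crossings thus already produce a negative value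
      followed by a positive one.\<close>
    define h where "h = min (min d d') (\<rho>' - \<rho>) / 3"
    have "h > 0" using d(1) d'(1) \<open>\<rho> < \<rho>'\<close> by (simp add: h_def)
    moreover have "3 * h \<le> d" "3 * h \<le> d'" "3 * h \<le> \<rho>' - \<rho>" by (auto simp: h_def)
    ultimately show False
      using QI[of "\<rho> + h" "\<rho>' - h"] d(2)[of h] d'(2)[of h] int \<open>D \<sigma> \<rho> = 0\<close> \<open>D \<sigma> \<rho>' = 0\<close> by auto
  qed
qed

text \<open>For a small slope the nonlinear term is a small multiple of \<open>v\<close>. Sturm
  comparison with \<open>v'' = - k^2 v\<close>, where still \<open>k (b - a) < pi\<close>, then
  pushes the first zero beyond \<open>b\<close>.\<close>

lemma small_slope_positive: "\<exists>s0>0. \<forall>s. 0 < s \<longrightarrow> s \<le> s0 \<longrightarrow> V s b > 0"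
proof -
  have "sqrt lam < pi / (b - a)"
    using short ab by (simp add: pos_less_divide_eq)
  then have "(sqrt lam)\<^sup>2 < (pi / (b - a))\<^sup>2"
    using lam_pos by (intro power_strict_mono) auto
  then have gap: "lam < (pi / (b - a))\<^sup>2" using lam_pos by simp
  \<comment> \<open>Half of the gap between \<open>lam\<close> and the first eigenvalue is left for
    the nonlinear term.\<close>
  define d where "d = ((pi / (b - a))\<^sup>2 - lam) / 2"
  have d: "d > 0" "lam + d < (pi / (b - a))\<^sup>2" using gap by (auto simp: d_def field_simps)
  define k where "k = sqrt (lam + d)"
  have k: "k > 0" "k\<^sup>2 = lam + d" using lam_pos d by (auto simp: k_def)
  have "k < pi / (b - a)"
    using d(2) ab pi_gt_zero by (intro power_less_imp_less_base[of k 2]) (auto simp: k)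
  then have kpi: "k * (b - a) < pi" using ab by (simp add: pos_less_divide_eq)
  \<comment> \<open>The height up to which the nonlinear term is at most \<open>d v\<close>; a slope
    of at most \<open>q / (b - a)\<close> keeps the solution below it.\<close>
  define q where "q = (d / a powr (1 - p)) powr (1 / (p - 1))"
  have q: "q > 0" "a powr (1 - p) * q powr (p - 1) = d"
    using d a_pos p_gt by (auto simp: q_def powr_powr)
  have "V s b > 0" if s: "0 < s" "s \<le> q / (b - a)" for s
  proof (rule ccontr)
    assume nb: "\<not> V s b > 0"
    obtain e where e: "e > 0" "\<And>t. a < t \<Longrightarrow> t < a + e \<Longrightarrow> t \<le> b \<Longrightarrow> V s t > 0"
      using V_pos_near_a[OF s(1)] by blast
    obtain z where z: "a < z" "z \<le> b" "V s z = 0" "\<And>t. a < t \<Longrightarrow> t < z \<Longrightarrow> V s t > 0"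
      using first_zero[OF V_cont[of s] e ab order_refl] nb by (auto simp: not_less)
    define W where "W t = Y s t * sin (k * (t - a)) - V s t * (k * cos (k * (t - a)))" for t
    have "W a \<le> W z"
    proof (rule DERIV_nonneg_imp_increasing_open[of a z W])
      show "a \<le> z" using z by simp
      show "continuous_on {a..z} W"
        unfolding W_def using z
        by (intro continuous_intros continuous_on_subset[OF V_cont] continuous_on_subset[OF Y_cont]) auto
      fix t assume t: "a < t" "t < z"
      have t': "a < t" "t < b" using t z by auto
      have Vt: "V s t > 0" using z(4) t by blast
      have "V s t \<le> s * (t - a)"
        using V_le[of z t s] z t by simp
      also have "\<dots> \<le> s * (b - a)" using s t' by (intro mult_left_mono) auto
      also have "\<dots> \<le> q" using s ab by (simp add: field_simps)
      finally have "V s t powr (p - 1) \<le> q powr (p - 1)"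
        using Vt p_gt by (intro powr_mono2) auto
      moreover have "t powr (1 - p) \<le> a powr (1 - p)"
        using t a_pos p_gt by (intro powr_mono2') auto
      ultimately have "t powr (1 - p) * V s t powr (p - 1) \<le> d"
        using q(2) mult_mono[of "t powr (1 - p)" "a powr (1 - p)" "V s t powr (p - 1)" "q powr (p - 1)"] by simp
      then have "t powr (1 - p) * V s t powr (p - 1) * V s t \<le> d * V s t"
        using Vt by (intro mult_right_mono) auto
      moreover have "V s t powr (p - 1) * V s t = V s t powr p"
        using Vt by (simp add: powr_diff)
      ultimately have "t powr (1 - p) * V s t powr p \<le> d * V s t"
        by (simp add: mult.assoc)
      moreover have "t powr (1 - p) * clip_pow p R (V s t) \<le> t powr (1 - p) * V s t powr p"
        using Vt R_nonneg p_gt by (intro mult_left_mono clip_pow_le) auto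
      ultimately have F: "F t (V s t) \<le> k\<^sup>2 * V s t"
        by (simp add: force_clipped_def k distrib_right)
      have "k * (t - a) \<le> k * (b - a)" using k t' by (intro mult_left_mono) auto
      then have sn: "sin (k * (t - a)) \<ge> 0"
        using kpi k(1) t' by (intro sin_ge_zero) (linarith | simp)+
      have "(W has_real_derivative (k\<^sup>2 * V s t - F t (V s t)) * sin (k * (t - a))) (at t)"
        unfolding W_def using V_deriv'[OF t', of s] Y_deriv'[OF t', of s]
        by (auto intro!: derivative_eq_intros simp: power2_eq_square algebra_simps)
      moreover have "(k\<^sup>2 * V s t - F t (V s t)) * sin (k * (t - a)) \<ge> 0"
        using F sn by simp
      ultimately show "\<exists>y. (W has_real_derivative y) (at t) \<and> y \<ge> 0" by blast
    qed
    then have "Y s z * sin (k * (z - a)) \<ge> 0"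
      using z(3) V_a by (simp add: W_def)
    moreover have "k * (z - a) \<le> k * (b - a)" using k z by (intro mult_left_mono) auto
    then have "k * (z - a) < pi" using kpi by linarith
    then have "sin (k * (z - a)) > 0" using k(1) z(1) by (intro sin_gt_zero) auto
    moreover have "Y s z < 0"
      using Y_neg_at_zero[OF s(1) z] .
    ultimately show False by (simp add: zero_le_mult_iff)
  qed
  then show ?thesis
    using q(1) ab by (intro exI[of _ "q / (b - a)"]) auto
qed

end

section \<open>A priori bound for the initial slope\<close>

lemma chord_below:
  fixes v y :: "real \<Rightarrow> real"
  assumes d: "\<And>t. t \<in> {a..b} \<Longrightarrow> (v has_real_derivative y t) (at t within {a..b})"
    and anti: "\<And>t t'. a \<le> t \<Longrightarrow> t \<le> t' \<Longrightarrow> t' \<le> b \<Longrightarrow> y t' \<le> y t"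
    and x: "a \<le> x" "x < t" "t < z" "z \<le> b"
  shows "(z - t) * v x + (t - x) * v z \<le> (z - x) * v t"
proof -
  obtain t1 where t1: "x < t1" "t1 < t" "v t - v x = (t - x) * y t1"
    using mvt_Icc[OF d, of x t] x by auto
  obtain t2 where t2: "t < t2" "t2 < z" "v z - v t = (z - t) * y t2"
    using mvt_Icc[OF d, of t z] x by auto
  have "(z - t) * ((t - x) * y t2) \<le> (z - t) * ((t - x) * y t1)"
    using anti[of t1 t2] x t1 t2 by (intro mult_left_mono) auto
  then have "(t - x) * (v z - v t) \<le> (z - t) * (v t - v x)"
    by (simp only: t1(3) t2(3)) (simp add: mult_ac)
  then show ?thesis by (simp add: algebra_simps)
qed

text \<open>A nonnegative concave solution is at least half its midpoint value on the middle half of the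
  interval. There the superlinear term bends it down, which bounds the midpoint value and then
  the slope.\<close>

lemma slope_bound:
  fixes lam p a b :: real
  assumes "0 < a" "a < b" "lam > 0" "p > 1"
  obtains S where "\<And>F v y. ode_sol F a b v y \<Longrightarrow> v a = 0 \<Longrightarrow> (\<And>r. r \<in> {a..b} \<Longrightarrow> v r \<ge> 0) \<Longrightarrow>
    (\<And>r. r \<in> {a..b} \<Longrightarrow> F r (v r) = lam * v r + r powr (1 - p) * v r powr p) \<Longrightarrow> y a \<le> S"
proof
  define K0 where "K0 = b powr (1 - p)"
  \<comment> \<open>With \<open>l = (b - a) / 4\<close> the estimate \<open>K l^2 <= 2 m\<close>
    below becomes \<open>(m / 2) powr (p - 1) <= 4 / (K0 l^2)\<close>, whence 64.\<close>
  define M where "M = 2 * (64 / ((b - a)\<^sup>2 * K0)) powr (1 / (p - 1))"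
  define C where "C = lam * (2 * M) + a powr (1 - p) * (2 * M) powr p"
  have K0: "K0 > 0" using assms by (simp add: K0_def)
  fix F v y
  assume sol: "ode_sol F a b v y" and va: "v a = 0" and nn: "\<And>r. r \<in> {a..b} \<Longrightarrow> v r \<ge> 0"
    and F: "\<And>r. r \<in> {a..b} \<Longrightarrow> F r (v r) = lam * v r + r powr (1 - p) * v r powr p"
  note dv = ode_solD(1)[OF sol] and dy = ode_solD(2)[OF sol]
  note dv' = ode_sol_interior(1)[OF sol] and dy' = ode_sol_interior(2)[OF sol]
  have F_ge: "F r (v r) \<ge> K0 * v r powr p" if "r \<in> {a..b}" for r
  proof -
    have "K0 \<le> r powr (1 - p)"
      unfolding K0_def using that assms by (intro powr_mono2') auto
    then have "K0 * v r powr p \<le> r powr (1 - p) * v r powr p"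
      by (intro mult_right_mono) auto
    moreover have "lam * v r \<ge> 0" using nn[OF that] assms by simp
    ultimately show ?thesis using F[OF that] by simp
  qed
  have F_nn: "F r (v r) \<ge> 0" if "r \<in> {a..b}" for r
    using F_ge[OF that] K0 by (meson less_imp_le mult_nonneg_nonneg order_trans powr_ge_zero)
  have anti: "y t' \<le> y t" if t: "a \<le> t" "t \<le> t'" "t' \<le> b" for t t'
  proof (cases "t = t'")
    case False
    then obtain x where x: "t < x" "x < t'" "y t' - y t = (t' - t) * - F x (v x)"
      using mvt_Icc[OF dy, of t t'] t by auto
    then have "(t' - t) * F x (v x) \<ge> 0" using F_nn[of x] t by auto
    then show ?thesis using x(3) by simp
  qed simp
  note chord = chord_below[OF dv anti]
  define c where "c = (a + b) / 2"
  have c: "a < c" "c < b" "c - a = (b - a) / 2" "b - c = (b - a) / 2"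
    using assms by (auto simp: c_def field_simps)
  define m where "m = v c"
  have m: "m \<ge> 0" using nn[of c] c by (simp add: m_def)
  define l where "l = (b - a) / 4"
  have l: "l > 0" "c - a = 2 * l" "b - c = 2 * l" "b - a = 4 * l" using assms c by (auto simp: l_def)
  have half: "v r \<ge> m / 2" if r: "c - l \<le> r" "r \<le> c + l" for r
  proof -
    have ar: "a < r" "r < b" using r l by linarith+
    consider "r = c" | "r < c" | "c < r" by linarith
    then show ?thesis
    proof cases
      case 1 then show ?thesis using m by (simp add: m_def)
    next
      case 2
      have "(r - a) * m \<le> (c - a) * v r"
        using chord[of a r c] 2 ar va c(2) by (simp add: m_def)
      moreover have "l * m \<le> (r - a) * m" using r l m by (intro mult_right_mono) auto
      ultimately have "l * m \<le> 2 * l * v r" unfolding l(2) by linarith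
      then have "l * m \<le> l * (2 * v r)" by (simp add: mult_ac)
      then show ?thesis using l(1) by simp
    next
      case 3
      have "(b - r) * m + (r - c) * v b \<le> (b - c) * v r"
        using chord[of c r b] 3 ar c(1) by (simp add: m_def)
      moreover have "(r - c) * v b \<ge> 0" using 3 nn[of b] assms by simp
      moreover have "l * m \<le> (b - r) * m" using r l m by (intro mult_right_mono) auto
      ultimately have "l * m \<le> 2 * l * v r" unfolding l(3) by linarith
      then have "l * m \<le> l * (2 * v r)" by (simp add: mult_ac)
      then show ?thesis using l(1) by simp
    qed
  qed
  define K where "K = K0 * (m / 2) powr p"
  have F_K: "F r (v r) \<ge> K" if "c - l \<le> r" "r \<le> c + l" for r
  proof -
    have "K \<le> K0 * v r powr p"
      unfolding K_def using half[OF that] m K0 assms by (intro mult_left_mono powr_mono2) auto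
    then show ?thesis using F_ge[of r] that l c by auto
  qed
  \<comment> \<open>A symmetric second difference: \<open>v'' <= - K\<close> on the middle half
    makes the sum nonincreasing in \<open>h\<close>, and \<open>v >= 0\<close> at the far points
    leaves \<open>K l^2 <= 2 m\<close>.\<close>
  have "v (c + l) + v (c - l) + K * l\<^sup>2 \<le> v (c + 0) + v (c - 0) + K * 0\<^sup>2"
  proof (rule DERIV_nonpos_imp_decreasing_open[of 0 l "\<lambda>h. v (c + h) + v (c - h) + K * h\<^sup>2"])
    have "continuous_on {0..l} (\<lambda>h. v (c + h))" "continuous_on {0..l} (\<lambda>h. v (c - h))"
      by (rule continuous_on_compose2[OF ode_sol_continuous(1)[OF sol]]; use l c in \<open>auto intro!: continuous_intros\<close>)+
    then show "continuous_on {0..l} (\<lambda>h. v (c + h) + v (c - h) + K * h\<^sup>2)"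
      by (intro continuous_intros)
    fix h assume h: "0 < h" "h < l"
    have in1: "a < c + h" "c + h < b" "a < c - h" "c - h < b" using h l c by auto
    have "((\<lambda>h. v (c + h)) has_real_derivative y (c + h) * 1) (at h)"
      by (rule DERIV_chain2[where f = v and g = "\<lambda>h. c + h", OF dv'[OF in1(1,2)]]) (auto intro!: derivative_eq_intros)
    moreover have "((\<lambda>h. v (c - h)) has_real_derivative y (c - h) * (- 1)) (at h)"
      by (rule DERIV_chain2[where f = v and g = "\<lambda>h. c - h", OF dv'[OF in1(3,4)]]) (auto intro!: derivative_eq_intros)
    ultimately have "((\<lambda>h. v (c + h) + v (c - h) + K * h\<^sup>2) has_real_derivative
        y (c + h) - y (c - h) + 2 * K * h) (at h)"
      by (auto intro!: derivative_eq_intros)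
    moreover obtain x where x: "c - h < x" "x < c + h" "y (c + h) - y (c - h) = (c + h - (c - h)) * - F x (v x)"
      using mvt_Icc[OF dy, of "c - h" "c + h"] in1 h by auto
    moreover have "h * K \<le> h * F x (v x)"
      using F_K[of x] x h by (intro mult_left_mono) auto
    moreover from x(3) have "y (c + h) - y (c - h) = - 2 * (h * F x (v x))" by simp
    ultimately show "\<exists>z. ((\<lambda>h. v (c + h) + v (c - h) + K * h\<^sup>2) has_real_derivative z) (at h) \<and> z \<le> 0"
      by (intro exI[of _ "y (c + h) - y (c - h) + 2 * K * h"] conjI) (assumption, simp add: mult_ac)
  qed (use l in simp)
  moreover have "v (c + l) \<ge> 0" "v (c - l) \<ge> 0" using nn l c by auto
  ultimately have Kl: "K * l\<^sup>2 \<le> 2 * m" by (simp add: m_def)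
  have mM: "m \<le> M"
  proof (cases "m = 0")
    case True
    then show ?thesis using K0 by (simp add: M_def)
  next
    case False
    then have mp: "m > 0" using m by simp
    have "K = K0 * ((m / 2) powr (p - 1) * (m / 2))"
      unfolding K_def using mp by (simp add: powr_diff)
    then have "K * l\<^sup>2 = (K0 * (m / 2) powr (p - 1) * l\<^sup>2) * (m / 2)"
      by (simp only: mult_ac)
    then have "(K0 * (m / 2) powr (p - 1) * l\<^sup>2) * (m / 2) \<le> 4 * (m / 2)"
      using Kl by linarith
    then have "K0 * (m / 2) powr (p - 1) * l\<^sup>2 \<le> 4" using mp by simp
    then have "(m / 2) powr (p - 1) \<le> 64 / ((b - a)\<^sup>2 * K0)"
      using K0 l(1) by (simp add: l(4) field_simps power_mult_distrib)
    then have "((m / 2) powr (p - 1)) powr (1 / (p - 1)) \<le> (64 / ((b - a)\<^sup>2 * K0)) powr (1 / (p - 1))"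
      using assms by (intro powr_mono2) auto
    then show ?thesis using mp assms by (simp add: powr_powr M_def)
  qed
  have v2M: "v r \<le> 2 * M" if r: "a \<le> r" "r \<le> c" for r
  proof -
    have "v r \<le> 2 * m"
    proof (cases "r = c")
      case True then show ?thesis using m by (simp add: m_def)
    next
      case False
      then have "(b - c) * v r + (c - r) * v b \<le> (b - r) * m"
        using chord[of r c b] r c(2) by (simp add: m_def)
      moreover have "(c - r) * v b \<ge> 0" using r nn[of b] assms by simp
      moreover have "(b - r) * m \<le> 4 * l * m" using r l m by (intro mult_right_mono) auto
      ultimately have "2 * l * v r \<le> 4 * l * m" unfolding l(3) by linarith
      then have "l * (2 * v r) \<le> l * (4 * m)" by (simp add: mult_ac)
      then show ?thesis using l(1) by simp
    qed
    then show ?thesis using mM by simp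
  qed
  have F_C: "F r (v r) \<le> C" if r: "a \<le> r" "r \<le> c" for r
  proof -
    have "r powr (1 - p) \<le> a powr (1 - p)" using r assms by (intro powr_mono2') auto
    moreover have "v r powr p \<le> (2 * M) powr p"
      using v2M[OF r] nn[of r] r c assms by (intro powr_mono2) auto
    ultimately have "r powr (1 - p) * v r powr p \<le> a powr (1 - p) * (2 * M) powr p"
      by (intro mult_mono) auto
    moreover have "lam * v r \<le> lam * (2 * M)" using v2M[OF r] assms by (intro mult_left_mono) auto
    ultimately show ?thesis using F[of r] r c by (simp add: C_def)
  qed
  \<comment> \<open>The slope loses at most \<open>C (b - a)\<close> up to \<open>c\<close>, while
    some slope there equals \<open>m / (2 l)\<close>; together these bound
    \<open>y a\<close>.\<close>
  have y_ge: "y t \<ge> y a - C * (b - a)" if t: "a < t" "t \<le> c" for t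
  proof -
    obtain x where x: "a < x" "x < t" "y t - y a = (t - a) * - F x (v x)"
      using mvt_Icc[OF dy, of a t] t c by auto
    have "(t - a) * F x (v x) \<le> (b - a) * C"
      using F_C[of x] F_nn[of x] x t c by (intro mult_mono) auto
    then show ?thesis using x(3) by (simp add: mult.commute)
  qed
  obtain x where x: "a < x" "x < c" "v c - v a = (c - a) * y x"
    using mvt_Icc[OF dv, of a c] c by auto
  have "2 * l * (y a - C * (b - a)) \<le> 2 * l * y x"
    using y_ge[of x] x(1,2) l(1) by (intro mult_left_mono) auto
  moreover have "2 * l * y x = m" using x(3) va l(2) by (simp add: m_def)
  ultimately have "2 * l * (y a - C * (b - a)) \<le> M" using mM by linarith
  then have "y a - C * (b - a) \<le> M / (2 * l)"
    using l(1) by (simp add: pos_le_divide_eq mult.commute)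
  then show "y a \<le> M / (2 * ((b - a) / 4)) + C * (b - a)"
    by (simp add: l_def)
qed

section \<open>The boundary value problem\<close>

text \<open>Translates the hypotheses into properties of the phase \<open>X\<close>: the first makes
  it monotone on the interval, the second is \<open>X a >= 0\<close>, the third is
  \<open>X r0 <= 0\<close>.\<close>

lemma multiplier_sign:
  fixes p lam a b r0 :: real
  defines "w \<equiv> sqrt lam" and "k \<equiv> 2 * (p - 1) / (p + 3)"
  defines "G \<equiv> multiplier_defect w k a b"
  assumes hp: "p > 5" and hlam: "lam > 0" and ha: "0 < a" and hab: "a < b"
    and hr0: "r0 = sqrt (2 * (p - 5) / (lam * (p + 3)^2))"
    and hcases:
      "((r0 \<le> a \<or> b \<le> r0) \<and> b < a + pi / sqrt lam)
       \<or> (a < r0 \<and> r0 < b \<and>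
          a + pi / sqrt lam - (1 / sqrt lam) * arctan (2 * (p + 3) * sqrt lam / (p - 5) * a) \<le> b \<and>
          b < a + pi / sqrt lam)
       \<or> (a < r0 \<and> r0 < b \<and>
          b \<le> - a + (1 / sqrt lam) * (2 * sqrt (2 * (p - 5)) / (p + 3)
                                       + arccos (- sqrt ((p - 5) / (p + 3)))))"
  shows "w * (b - a) < pi" "G a > 0" "G b < 0"
    and "\<And>r r'. a \<le> r \<Longrightarrow> r < r' \<Longrightarrow> r' \<le> b \<Longrightarrow> G r < 0 \<Longrightarrow> 0 < G r' \<Longrightarrow> False"
proof -
  have w: "w > 0" using hlam by (simp add: w_def)
  have k: "k - 1 = (p - 5) / (p + 3)" "2 - k = 8 / (p + 3)" "1 < k" "k < 2"
    using hp by (auto simp: k_def field_simps)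
  define e where "e = sqrt (2 * (p - 5))"
  have e: "e > 0" "e\<^sup>2 = 2 * (p - 5)" using hp by (auto simp: e_def)
  \<comment> \<open>The argument of the arctangent in \<open>X\<close> at \<open>r0\<close>, see
    \<open>arg\<close>.\<close>
  define q where "q = 4 / e"
  have q: "q > 0" using e by (simp add: q_def)
  have wr0: "w * r0 = e / (p + 3)"
    using hp hlam by (simp add: w_def hr0 e_def real_sqrt_divide real_sqrt_mult)
  have r0: "r0 \<ge> 0" using hp hlam by (simp add: hr0)
  have wr0_sq: "4 * (w * r0)\<^sup>2 = (k - 1) * (2 - k)"
    unfolding wr0 power_divide e(2) k(1,2) by (simp add: power2_eq_square)
  have q2: "1 + q\<^sup>2 = (p + 3) / (p - 5)"
    using hp by (simp add: q_def power_divide e(2) field_simps)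
  have arg: "2 * w * r0 / (k - 1) = q"
  proof -
    have "2 * w * r0 / (k - 1) = 2 * e / (p - 5)"
      using wr0 hp by (simp add: k(1) mult.assoc)
    also have "\<dots> = 4 * e / e\<^sup>2" unfolding e(2) using hp by (simp add: field_simps)
    also have "\<dots> = q" using e(1) by (simp add: q_def power2_eq_square)
    finally show ?thesis .
  qed
  have acos: "arccos (- sqrt ((p - 5) / (p + 3))) = pi - arctan q"
  proof -
    have "sqrt ((p - 5) / (p + 3)) = cos (arctan q)"
      unfolding cos_arctan q2 by (simp add: real_sqrt_divide)
    moreover have "arccos (cos (arctan q)) = arctan q"
      using q less_imp_le[OF arctan_ubound[of q]] pi_gt_zero by (intro arccos_cos) (simp, linarith)
    ultimately show ?thesis
      by (simp add: arccos_minus)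
  qed
  define X where "X r = w * (a + b - 2 * r) + arctan (2 * w * r / (k - 1)) - pi" for r
  have gap: "w * (b - a) < pi" if "b < a + pi / sqrt lam"
  proof -
    have "b - a < pi / w" using that by (simp add: w_def)
    then show ?thesis using w by (simp add: pos_less_divide_eq mult.commute)
  qed
  have "w * (b - a) < pi \<and> (r0 \<le> a \<or> b \<le> r0 \<or> X a \<ge> 0 \<or> X r0 \<le> 0)"
    using hcases
  proof (elim disjE)
    assume "(r0 \<le> a \<or> b \<le> r0) \<and> b < a + pi / sqrt lam"
    then show ?thesis using gap by blast
  next
    assume *: "a < r0 \<and> r0 < b \<and>
          a + pi / sqrt lam - (1 / sqrt lam) * arctan (2 * (p + 3) * sqrt lam / (p - 5) * a) \<le> b \<and>
          b < a + pi / sqrt lam"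
    have "2 * (p + 3) * sqrt lam / (p - 5) * a = 2 * w * a / (k - 1)"
      using hp by (simp add: k(1) w_def)
    with * have "a + pi / w - (1 / w) * arctan (2 * w * a / (k - 1)) \<le> b"
      by (simp add: w_def)
    then have "w * (a + pi / w - (1 / w) * arctan (2 * w * a / (k - 1))) \<le> w * b"
      using w by (intro mult_left_mono) auto
    then have "X a \<ge> 0"
      using w by (simp add: X_def algebra_simps)
    then show ?thesis using gap * by blast
  next
    assume *: "a < r0 \<and> r0 < b \<and>
          b \<le> - a + (1 / sqrt lam) * (2 * sqrt (2 * (p - 5)) / (p + 3)
                                       + arccos (- sqrt ((p - 5) / (p + 3))))"
    then have "b \<le> - a + (1 / w) * (2 * (w * r0) + (pi - arctan q))"
      unfolding acos wr0 by (simp add: e_def w_def)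
    then have "w * b \<le> w * (- a + (1 / w) * (2 * (w * r0) + (pi - arctan q)))"
      using w by (intro mult_left_mono) auto
    then have wb: "w * a + w * b \<le> 2 * (w * r0) + pi - arctan q"
      using w by (simp add: algebra_simps)
    then have "X r0 \<le> 0"
      by (simp add: X_def arg) (simp add: algebra_simps)
    \<comment> \<open>The third alternative states no eigenvalue bound; it follows because
      \<open>2 w r0 = sin x cos x <= x\<close> for \<open>x = arctan q\<close>.\<close>
    moreover have "2 * (w * r0) \<le> arctan q"
    proof -
      have "2 * (w * r0) = 4 / e * (e\<^sup>2 / 2) / (p + 3)"
        using e(1) by (simp add: wr0 power2_eq_square)
      also have "e\<^sup>2 / 2 = p - 5"
        using e(2) by simp
      also have "4 / e * (p - 5) / (p + 3) = q / (1 + q\<^sup>2)"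
        unfolding q2 by (simp add: q_def)
      also have "\<dots> = sin (arctan q) * cos (arctan q)"
        by (simp add: sin_arctan cos_arctan add_nonneg_nonneg)
      also have "\<dots> \<le> sin (arctan q) * 1"
        using q by (intro mult_left_mono) (auto simp: sin_arctan)
      also have "\<dots> \<le> arctan q"
        using q sin_x_le_x[of "arctan q"] by simp
      finally show ?thesis .
    qed
    moreover have "w * a > 0" using w ha by simp
    ultimately show ?thesis using wb by (simp add: right_diff_distrib)
  qed
  then have *: "w * (b - a) < pi" "r0 \<le> a \<or> b \<le> r0 \<or> X a \<ge> 0 \<or> X r0 \<le> 0" by auto
  show "w * (b - a) < pi" by fact
  note aux = multiplier_sign_aux[OF w k(3,4) ha hab *(1) r0 wr0_sq *(2)[unfolded X_def], folded G_def]
  show "G a > 0" "G b < 0" using aux(1,2) by auto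
  show False if "a \<le> r" "r < r'" "r' \<le> b" "G r < 0" "0 < G r'" for r r'
    using aux(3) that by blast
qed

section \<open>Boundary value solutions as roots of the shooting map\<close>

lemma shooting_exists:
  assumes "0 < a" "a < b" "lam > 0" "p > 1" "R \<ge> 0" "sqrt lam * (b - a) < pi"
  obtains V Y where "shooting lam p a b R V Y"
proof -
  have "\<exists>v y. ode_sol (force_clipped lam p R) a b v y \<and> v a = 0 \<and> y a = s" for s
  proof (rule ode_sol_exists[of a b "lam + a powr (1 - p) * (p * R powr (p - 1))" "force_clipped lam p R" s])
    show "lam + a powr (1 - p) * (p * R powr (p - 1)) \<ge> 0" using assms by simp
    show "continuous_on ({a..b} \<times> UNIV) (\<lambda>(r, x). force_clipped lam p R r x)"
      using assms by (intro force_clipped_continuous) auto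
  qed (use assms force_clipped_lipschitz in auto)
  then obtain V Y where "\<And>s. ode_sol (force_clipped lam p R) a b (V s) (Y s) \<and> V s a = 0 \<and> Y s a = s"
    by metis
  then have "shooting lam p a b R V Y"
    using assms by (simp add: shooting_def)
  then show ?thesis using that by blast
qed

text \<open>\<open>y\<close> is obtained before \<open>R\<close>, so two solutions can share one
  clipping level. Concavity of \<open>r u\<close> keeps it below \<open>y a (b - a)\<close>, where
  the clip is inactive.\<close>

lemma pos_sol_imp_ode_sol:
  assumes u: "pos_sol lam p a b u" and "0 < a" "a < b" "lam > 0" "p > 1"
  obtains y where "y a > 0" "\<And>R. y a * (b - a) \<le> R \<Longrightarrow> ode_sol (force_clipped lam p R) a b (\<lambda>r. r * u r) y"
proof -
  obtain u' u'' where du: "\<And>x. x \<in> {a..b} \<Longrightarrow> (u has_real_derivative u' x) (at x within {a..b})"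
      and du': "\<And>x. x \<in> {a..b} \<Longrightarrow> (u' has_real_derivative u'' x) (at x within {a..b})"
      and cont: "continuous_on {a..b} u''"
      and eq: "\<And>r. r \<in> {a<..<b} \<Longrightarrow> u'' r + 2 / r * u' r + lam * u r + u r powr p = 0"
    using u unfolding pos_sol_def by blast
  have zero: "u a = 0" "u b = 0" and pos: "\<And>r. r \<in> {a<..<b} \<Longrightarrow> u r > 0"
    using u unfolding pos_sol_def by blast+
  have nn: "u r \<ge> 0" if "r \<in> {a..b}" for r
    using that pos[of r] zero by (cases "r = a \<or> r = b") force+
  have cu: "continuous_on {a..b} u" "continuous_on {a..b} u'"
    by (rule DERIV_continuous_on, erule du) (rule DERIV_continuous_on, erule du')
  \<comment> \<open>The equation is given on the open interval only; continuity of
    \<open>u''\<close> carries it to the end points, where \<open>ode_sol\<close> asks for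
    it.\<close>
  have eq': "u'' r + 2 / r * u' r + lam * u r + u r powr p = 0" if "r \<in> {a..b}" for r
  proof (rule continuous_constant_on_closure[of "{a<..<b}" "\<lambda>r. u'' r + 2 / r * u' r + lam * u r + u r powr p"])
    have "continuous_on {a..b} (\<lambda>r. u r powr p)"
      using nn assms by (intro continuous_on_powr' cu continuous_on_const) auto
    moreover have "continuous_on {a..b} (\<lambda>r. 2 / r)"
      using assms by (intro continuous_on_divide continuous_on_const continuous_on_id) auto
    ultimately show "continuous_on (closure {a<..<b}) (\<lambda>r. u'' r + 2 / r * u' r + lam * u r + u r powr p)"
      unfolding closure_greaterThanLessThan[OF \<open>a < b\<close>]
      by (intro continuous_on_add continuous_on_mult continuous_on_const cont cu)
  qed (use eq that assms in \<open>auto simp: closure_greaterThanLessThan\<close>)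
  define y where "y r = u r + r * u' r" for r
  have dv: "((\<lambda>r. r * u r) has_real_derivative y r) (at r within {a..b})" if "r \<in> {a..b}" for r
    unfolding y_def using du[OF that] by (auto intro!: derivative_eq_intros)
  define Fr where "Fr r = lam * (r * u r) + r powr (1 - p) * (r * u r) powr p" for r
  have dy: "(y has_real_derivative - Fr r) (at r within {a..b})" if r: "r \<in> {a..b}" for r
  proof -
    have "r > 0" using r assms by simp
    have d: "(y has_real_derivative 2 * u' r + r * u'' r) (at r within {a..b})"
      unfolding y_def using du[OF r] du'[OF r] by (auto intro!: derivative_eq_intros)
    have "r powr (1 - p) * (r * u r) powr p = r * u r powr p"
      using \<open>r > 0\<close> nn[OF r] by (simp add: powr_mult powr_diff)
    moreover have "r * (u'' r + 2 / r * u' r + lam * u r + u r powr p) = 0"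
      using eq'[OF r] by simp
    then have "2 * u' r + r * u'' r + (lam * (r * u r) + r * u r powr p) = 0"
      using \<open>r > 0\<close> by (simp add: algebra_simps)
    ultimately have "2 * u' r + r * u'' r = - Fr r"
      unfolding Fr_def by linarith
    with d show ?thesis by simp
  qed
  have Fr_nn: "Fr r \<ge> 0" if "r \<in> {a..b}" for r
    using that nn[OF that] assms by (simp add: Fr_def)
  have y_le: "y r \<le> y a" if r: "r \<in> {a..b}" for r
  proof (cases "r = a")
    case False
    then obtain x where x: "a < x" "x < r" "y r - y a = (r - a) * - Fr x"
      using mvt_Icc[OF dy, of a r] r by auto
    moreover have "(r - a) * Fr x \<ge> 0" using Fr_nn[of x] x r by simp
    ultimately show ?thesis by simp
  qed simp
  have v_le: "r * u r \<le> y a * (r - a)" if r: "r \<in> {a..b}" for r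
  proof (cases "r = a")
    case False
    then obtain x where x: "a < x" "x < r" "r * u r - a * u a = (r - a) * y x"
      using mvt_Icc[OF dv, of a r] r by auto
    moreover have "(r - a) * y x \<le> (r - a) * y a" using y_le[of x] x r by (intro mult_left_mono) auto
    ultimately show ?thesis using zero by (simp add: mult.commute)
  qed (simp add: zero)
  define c where "c = (a + b) / 2"
  have c: "a < c" "c < b" using assms by (auto simp: c_def)
  then have "c * u c > 0" using pos[of c] assms by simp
  then have "y a * (c - a) > 0" using v_le[of c] c by simp
  then have ya: "y a > 0" using c by (simp add: zero_less_mult_iff)
  have v_le': "r * u r \<le> y a * (b - a)" if r: "r \<in> {a..b}" for r
  proof -
    have "y a * (r - a) \<le> y a * (b - a)" using ya r by (intro mult_left_mono) auto
    then show ?thesis using v_le[OF r] by linarith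
  qed
  show ?thesis
  proof (rule that[where y = y, OF ya])
    fix R assume R: "y a * (b - a) \<le> R"
    have "force_clipped lam p R r (r * u r) = Fr r" if "r \<in> {a..b}" for r
      using v_le'[OF that] nn[OF that] R that assms by (simp add: force_clipped_def Fr_def clip_pow_eq)
    then show "ode_sol (force_clipped lam p R) a b (\<lambda>r. r * u r) y"
      using dv dy by (simp add: ode_sol_def)
  qed
qed

context shooting
begin

lemma force_V_eq:
  assumes "s > 0" "V s b \<ge> 0" "s * (b - a) \<le> R" "a \<le> r" "r \<le> b"
  shows "F r (V s r) = lam * V s r + r powr (1 - p) * V s r powr p" "V s r \<ge> 0" "V s r \<le> s * (b - a)"
proof -
  show nn: "V s r \<ge> 0"
    using V_pos_interior[of s r] assms V_a[of s] by (cases "r = a \<or> r = b") force+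
  have "V s r \<le> s * (r - a)"
    using V_le[of b r s] V_pos_interior[of s] assms by simp
  also have "\<dots> \<le> s * (b - a)" using assms by (intro mult_left_mono) auto
  finally show "V s r \<le> s * (b - a)" .
  then show "F r (V s r) = lam * V s r + r powr (1 - p) * V s r powr p"
    using nn assms by (simp add: force_clipped_def clip_pow_eq)
qed

lemma root_imp_pos_sol:
  assumes s: "s > 0" "V s b = 0" "s * (b - a) \<le> R"
  shows "pos_sol lam p a b (\<lambda>r. V s r / r)"
proof -
  define u' where "u' r = Y s r / r - V s r / r\<^sup>2" for r
  define u'' where "u'' r = - F r (V s r) / r - 2 * Y s r / r\<^sup>2 + 2 * V s r / r ^ 3" for r
  have F: "F r (V s r) = lam * V s r + r powr (1 - p) * V s r powr p" if "r \<in> {a..b}" for r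
    using force_V_eq(1)[OF s(1) _ s(3), of r] s(2) that by simp
  have nz: "r \<noteq> 0" if "r \<in> {a..b}" for r using that a_pos by auto
  have d1: "((\<lambda>r. V s r / r) has_real_derivative u' x) (at x within {a..b})" if x: "x \<in> {a..b}" for x
    unfolding u'_def using V_deriv[OF x, of s] nz[OF x]
    by (auto intro!: derivative_eq_intros simp: field_simps power2_eq_square)
  have d2: "(u' has_real_derivative u'' x) (at x within {a..b})" if x: "x \<in> {a..b}" for x
    unfolding u'_def u''_def using V_deriv[OF x, of s] Y_deriv[OF x, of s] nz[OF x]
    by (auto intro!: derivative_eq_intros simp: field_simps power2_eq_square power3_eq_cube)
  have "continuous_on {a..b} (\<lambda>r. F r (V s r))"
  proof -
    have "continuous_on {a..b} (\<lambda>t. (t, V s t))"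
      using V_cont by (intro continuous_intros)
    from continuous_on_compose2[OF force_clipped_continuous[OF p_gt a_pos, of b lam R] this]
    show ?thesis by auto
  qed
  then have "continuous_on {a..b} u''"
    unfolding u''_def using nz
    by (intro continuous_intros V_cont Y_cont) auto
  moreover have "u'' r + 2 / r * u' r + lam * (V s r / r) + (V s r / r) powr p = 0" if "r \<in> {a<..<b}" for r
  proof -
    have r: "r \<in> {a..b}" "r > 0" using that a_pos by auto
    have "r powr (1 - p) = r / r powr p" using r by (simp add: powr_diff)
    moreover have "(V s r / r) powr p = V s r powr p / r powr p"
      using force_V_eq(2)[OF s(1) _ s(3), of r] s(2) r by (simp add: powr_divide)
    ultimately show ?thesis
      using r F[OF r(1)] by (simp add: u''_def u'_def) (simp add: field_simps power2_eq_square power3_eq_cube)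
  qed
  moreover have "V s r / r > 0" if "r \<in> {a<..<b}" for r
    using V_pos_interior[of s r] s that a_pos by simp
  ultimately show ?thesis
    unfolding pos_sol_def using d1 d2 s(2) V_a[of s]
    by (intro conjI exI[of _ u'] exI[of _ u''] ballI) auto
qed

text \<open>Small slopes give \<open>V x b > 0\<close>, so a least root \<open>s1\<close> exists
  and, by the intermediate value theorem, all smaller slopes end positive at \<open>b\<close>, as
  the deformation requires. If \<open>s\<close> and \<open>t\<close> differ, one of them exceeds
  \<open>s1\<close>.\<close>

lemma unique_root:
  defines "G \<equiv> multiplier_defect (sqrt lam) (2 * (p - 1) / (p + 3)) a b"
  assumes G: "G a > 0" "G b < 0"
      "\<And>r r'. a \<le> r \<Longrightarrow> r < r' \<Longrightarrow> r' \<le> b \<Longrightarrow> G r < 0 \<Longrightarrow> 0 < G r' \<Longrightarrow> False"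
    and s: "s > 0" "V s b = 0" "s * (b - a) \<le> R"
    and t: "t > 0" "V t b = 0" "t * (b - a) \<le> R"
  shows "s = t"
proof (rule ccontr)
  assume "s \<noteq> t"
  obtain s0 where s0: "s0 > 0" "\<And>x. 0 < x \<Longrightarrow> x \<le> s0 \<Longrightarrow> V x b > 0"
    using small_slope_positive by blast
  define Z where "Z = {x \<in> {s0..max s t}. V x b = 0}"
  have "closed Z"
    unfolding Z_def by (intro continuous_closed_preimage_constant V_b_continuous closed_atLeastAtMost)
  moreover have "bounded Z"
    by (rule bounded_subset[of "{s0..max s t}"]) (auto simp: Z_def)
  ultimately have "compact Z" by (simp add: compact_eq_bounded_closed)
  have st: "s \<in> Z" "t \<in> Z"
    using s0(2)[of s] s0(2)[of t] s t by (force simp: Z_def)+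
  then obtain s1 where s1: "s1 \<in> Z" "\<And>x. x \<in> Z \<Longrightarrow> s1 \<le> x"
    using compact_attains_inf[OF \<open>compact Z\<close>] by blast
  obtain s2 where s2: "s1 < s2" "s2 > 0" "V s2 b = 0" "s2 * (b - a) \<le> R"
    using \<open>s \<noteq> t\<close> s1(2)[OF st(1)] s1(2)[OF st(2)] s t by (cases "s1 = s") force+
  have s1': "0 < s1" "V s1 b = 0" "s0 \<le> s1" "s1 \<le> max s t"
    using s1(1) s0(1) by (auto simp: Z_def)
  have s1R: "s1 * (b - a) \<le> R"
    using s2(1,4) ab mult_right_mono[of s1 s2 "b - a"] by linarith
  have pos_b: "V x b > 0" if x: "0 < x" "x < s1" for x
  proof (rule ccontr)
    assume "\<not> V x b > 0"
    then have "V x b \<le> 0" by simp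
    moreover have "s0 < x" using s0(2)[of x] x calculation by force
    ultimately obtain z where "s0 \<le> z" "z \<le> x" "V z b = 0"
      using IVT2'[of "\<lambda>x. V x b" x 0 s0] s0 V_b_continuous by (auto intro: less_imp_le)
    then show False using s1(2)[of z] s1' x by (auto simp: Z_def)
  qed
  note pos = V_pos_interior[OF s1'(1)] V_pos_interior[OF s2(2)]
  show False
  proof (rule no_two_solutions_crossing_once[OF a_pos ab p_gt sol[of s1] sol[of s2], of "sqrt lam", folded G_def])
    show "F r (V s1 r) = (sqrt lam)\<^sup>2 * V s1 r + r powr (1 - p) * V s1 r powr p" if "a < r" "r < b" for r
      using force_V_eq(1)[OF s1'(1) _ s1R, of r] s1'(2) that lam_pos by simp
    show "F r (V s2 r) = (sqrt lam)\<^sup>2 * V s2 r + r powr (1 - p) * V s2 r powr p" if "a < r" "r < b" for r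
      using force_V_eq(1)[OF s2(2) _ s2(4), of r] s2(3) that lam_pos by simp
    show "Y s1 a < Y s2 a" using s2(1) by (simp add: Y_a)
    show False if "a \<le> r" "r < r'" "r' \<le> b" "V s2 r - V s1 r < 0" "0 < V s2 r' - V s1 r'" for r r'
      using single_crossing[OF s1'(1) s2(1) pos(2) s2(3) pos_b s1'(2) that] s2(3) by simp
  qed (use pos s1' s2 V_a G in auto)
qed

lemma root_exists:
  assumes s: "s > 0" and nb: "V s b \<le> 0"
  obtains t where "0 < t" "t \<le> s" "V t b = 0"
proof -
  obtain s0 where s0: "s0 > 0" "\<And>x. 0 < x \<Longrightarrow> x \<le> s0 \<Longrightarrow> V x b > 0"
    using small_slope_positive by blast
  have "s0 < s" using s0(2)[of s] s nb by force
  then obtain t where "s0 \<le> t" "t \<le> s" "V t b = 0"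
    using IVT2'[of "\<lambda>x. V x b" s 0 s0] s0 V_b_continuous nb by (auto intro: less_imp_le)
  then show ?thesis using that[of t] s0(1) by simp
qed

end

theorem theorem1p2:
  fixes p lam a b r0 :: real
  assumes hp: "p > 5" and hlam: "lam > 0" and ha: "0 < a" and hab: "a < b"
    and hr0: "r0 = sqrt (2 * (p - 5) / (lam * (p + 3)^2))"
    and hcases:
      "((r0 \<le> a \<or> b \<le> r0) \<and> b < a + pi / sqrt lam)
       \<or> (a < r0 \<and> r0 < b \<and>
          a + pi / sqrt lam - (1 / sqrt lam) * arctan (2 * (p + 3) * sqrt lam / (p - 5) * a) \<le> b \<and>
          b < a + pi / sqrt lam)
       \<or> (a < r0 \<and> r0 < b \<and>
          b \<le> - a + (1 / sqrt lam) * (2 * sqrt (2 * (p - 5)) / (p + 3)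
                                       + arccos (- sqrt ((p - 5) / (p + 3)))))"
  shows "(\<exists>u. pos_sol lam p a b u) \<and>
         (\<forall>u v. pos_sol lam p a b u \<and> pos_sol lam p a b v \<longrightarrow> (\<forall>r\<in>{a..b}. u r = v r))"
proof (intro conjI allI impI ballI)
  have p: "p > 1" using hp by simp
  note sgn = multiplier_sign[OF hp hlam ha hab hr0 hcases]
  note short = sgn(1)
  show "\<exists>u. pos_sol lam p a b u"
  proof -
    obtain S where S: "\<And>F v y. ode_sol F a b v y \<Longrightarrow> v a = 0 \<Longrightarrow> (\<And>r. r \<in> {a..b} \<Longrightarrow> v r \<ge> 0) \<Longrightarrow>
      (\<And>r. r \<in> {a..b} \<Longrightarrow> F r (v r) = lam * v r + r powr (1 - p) * v r powr p) \<Longrightarrow> y a \<le> S"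
      using slope_bound[OF ha hab hlam p] by blast
    \<comment> \<open>\<open>S\<close> is uniform in the force, so the clipping level may be fixed
      after it. A slope above \<open>S\<close> cannot end nonnegative at \<open>b\<close>, and
      \<open>R = s (b - a)\<close> covers all slopes up to \<open>s\<close>.\<close>
    define s where "s = max S 0 + 1"
    have s: "s > 0" "s > S" by (auto simp: s_def)
    define R where "R = s * (b - a)"
    have "R \<ge> 0" using s hab by (simp add: R_def)
    then obtain V Y where "shooting lam p a b R V Y"
      using shooting_exists[OF ha hab hlam p _ short] by blast
    then interpret shooting lam p a b R V Y .
    have "V s b \<le> 0"
    proof (rule ccontr)
      assume "\<not> V s b \<le> 0"
      then have "Y s a \<le> S"
        using force_V_eq[of s] s by (intro S[OF sol]) (auto simp: V_a R_def)
      then show False using s by (simp add: Y_a)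
    qed
    then obtain t where t: "0 < t" "t \<le> s" "V t b = 0"
      using root_exists[OF s(1)] by blast
    moreover have "t * (b - a) \<le> R"
      unfolding R_def using t hab by (intro mult_right_mono) auto
    ultimately show ?thesis using root_imp_pos_sol by blast
  qed
  fix u v r
  assume "pos_sol lam p a b u \<and> pos_sol lam p a b v" and r: "r \<in> {a..b}"
  then have u: "pos_sol lam p a b u" and v: "pos_sol lam p a b v" by auto
  obtain yu where yu: "yu a > 0" "\<And>R. yu a * (b - a) \<le> R \<Longrightarrow> ode_sol (force_clipped lam p R) a b (\<lambda>r. r * u r) yu"
    using pos_sol_imp_ode_sol[OF u ha hab hlam p] by metis
  obtain yv where yv: "yv a > 0" "\<And>R. yv a * (b - a) \<le> R \<Longrightarrow> ode_sol (force_clipped lam p R) a b (\<lambda>r. r * v r) yv"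
    using pos_sol_imp_ode_sol[OF v ha hab hlam p] by metis
  \<comment> \<open>One level for both solutions places them in the same shooting family.\<close>
  define R where "R = max (yu a * (b - a)) (yv a * (b - a))"
  have R: "yu a * (b - a) \<le> R" "yv a * (b - a) \<le> R" by (auto simp: R_def)
  then have "R \<ge> 0" using yu(1) hab by (smt (verit) mult_pos_pos)
  then obtain V Y where "shooting lam p a b R V Y"
    using shooting_exists[OF ha hab hlam p _ short] by blast
  then interpret shooting lam p a b R V Y .
  have ends: "a * u a = 0" "b * u b = 0" "a * v a = 0" "b * v b = 0"
    using u v by (auto simp: pos_sol_def)
  have V_u: "x * u x = V (yu a) x" and V_v: "x * v x = V (yv a) x" if "x \<in> {a..b}" for x
    using solution_is_V(1)[OF yu(2)[OF R(1)] ends(1) that] solution_is_V(1)[OF yv(2)[OF R(2)] ends(3) that] by auto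
  have "yu a = yv a"
  proof (rule unique_root[OF sgn(2,3) _ yu(1) _ R(1) yv(1) _ R(2)])
    show "V (yu a) b = 0" "V (yv a) b = 0"
      using V_u[of b] V_v[of b] ends hab by auto
  qed (erule sgn(4); assumption)
  then have "r * u r = r * v r" using V_u[OF r] V_v[OF r] by simp
  then show "u r = v r" using r ha by simp
qed

end
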